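(* Let $f:\mathbb{C}\to\mathbb{C}$ be a transcendental entire function with an unbounded Fatou component. Then the Julia set $J(f)$ is not locally connected.
   Context: For a transcendental entire function $f$, $f^n$ denotes the $n$th iterate. The Fatou set $F(f)$ is the set of $z\in\mathbb{C}$ such that $\{f^n:n\in\mathbb{N}\}$ is a normal family in some neighbourhood of $z$; the Julia set is $J(f)=\mathbb{C}\setminus F(f)$. A Fatou component is a connected component of $F(f)$. A Hausdorff space $X$ is locally connected at $x\in X$ if $x$ has arbitrarily small connected (not necessarily open) neighbourhoods in $X$; $X$ is locally connected if this holds at every $x\in X$. $J(f)$ carries the subspace topology from $\mathbb{C}$. *)

theory Defs
  imports "HOL-Complex_Analysis.Complex_Analysis"
begin

definition transcendental_entire :: "(complex \<Rightarrow> complex) \<Rightarrow> bool" where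
  "transcendental_entire f \<longleftrightarrow>
     f holomorphic_on UNIV \<and> \<not> (\<exists>p :: complex poly. \<forall>z. f z = poly p z)"

(* Normality in the extended sense of Montel, where locally uniform convergence to infinity
   is allowed. For holomorphic functions on a domain (a connected open set) this is
   sequential precompactness for locally uniform convergence in the spherical metric; on a
   disconnected open set the limit could be infinite on some components only, so normal_on is
   meant to be used on domains. *)
definition normal_on :: "complex set \<Rightarrow> (complex \<Rightarrow> complex) set \<Rightarrow> bool" where
  "normal_on U \<F> \<longleftrightarrow>
     (\<forall>g :: nat \<Rightarrow> complex \<Rightarrow> complex. range g \<subseteq> \<F> \<longrightarrow>
       (\<exists>r :: nat \<Rightarrow> nat. strict_mono r \<and>
         ((\<exists>h. \<forall>K. compact K \<and> K \<subseteq> U \<longrightarrow> uniform_limit K (g \<circ> r) h sequentially) \<or>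
          (\<forall>K. compact K \<and> K \<subseteq> U \<longrightarrow>
             (\<forall>B :: real. \<forall>\<^sub>F k in sequentially. \<forall>z\<in>K. B \<le> norm (g (r k) z))))))"

(* Every neighbourhood of z contains a connected open one, and normality passes to subdomains,
   so restricting to connected neighbourhoods loses nothing. The identity f ^^ 0 belongs to the
   family; adding one function to a family does not affect its normality. *)
definition fatou_set :: "(complex \<Rightarrow> complex) \<Rightarrow> complex set" where
  "fatou_set f =
     {z. \<exists>U. open U \<and> connected U \<and> z \<in> U \<and> normal_on U (range (\<lambda>n. f ^^ n))}"

definition julia_set :: "(complex \<Rightarrow> complex) \<Rightarrow> complex set" where
  "julia_set f = - fatou_set f"

end

(* Suppose that the Julia set J of f is locally connected. By Montel's theorem the iterates spread
any connected neighbourhood in J of a point of J over J, up to one point of any given finite set, so J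
is connected. If a bounded open set G meets J and has its boundary in J, then the unbounded Fatou
component meets some f^n(G) and hence the boundary of f^n(G), which lies in J. This is impossible,
so no compact subset of J separates a further point of J from infinity.
Now let A be a small compact connected neighbourhood in J of a point of J. Some iterate g takes a
value w in J at arbitrarily many points of A. Lift under g an arc from w that runs close to J, far out
and past no critical value: the lifts are disjoint, start in A, stay close to J and leave a fixed disc, so
by local connectedness three of them arrive at the same small connected piece B of J. With A and B
they form a theta-shaped configuration, and each of its three branches contains a point that can be
reached from infinity without touching the rest. This contradicts the non-planarity of K(3,3). *)

theory Submission
  imports Defs
begin

subsection \<open>Normal families and exceptional values\<close>

text \<open>The topological fact about J concerns points of J and compact subsets of J, while the
  lifts are only close to J. By compactness the fact survives a thickening of J, but the admissible
  thickness depends on a distance \<open>h\<close> that the accessible point keeps from the rest,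
  and the arc, hence the lifts, can only be chosen after that thickness is known. So the distance
  from a crossing point of one lift to the other lifts must be bounded below before the arc exists.
  On a circle without critical points of \<open>g\<close>, two lifts at the same parameter are in
  different sheets; at different parameters they can come close only if the arc returns to a place
  it has left. This is why the arcs must not backtrack, with a constant independent of their
  closeness to J. They run beside J because an arc in J might be unable to avoid the critical
  values. The K(3,3) has the two small pieces and infinity on one side and three crossing points on
  the other; its impossibility is derived from winding numbers of paths that need not be
  closed.\<close>

lemma montel_omitting_two_values:
  fixes F :: "nat \<Rightarrow> complex \<Rightarrow> complex"
  assumes S: "open S" "connected S" and hol: "\<And>k. F k holomorphic_on S"
    and ab: "a \<noteq> b" "\<And>k z. z \<in> S \<Longrightarrow> F k z \<noteq> a \<and> F k z \<noteq> b"
  obtains r :: "nat \<Rightarrow> nat" where "strict_mono r"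
    "(\<exists>h. \<forall>K. compact K \<and> K \<subseteq> S \<longrightarrow> uniform_limit K (F \<circ> r) h sequentially) \<or>
     (\<forall>K. compact K \<and> K \<subseteq> S \<longrightarrow> (\<forall>B :: real. \<forall>\<^sub>F k in sequentially. \<forall>z\<in>K. B \<le> norm (F (r k) z)))"
proof (cases "S = {}")
  case True
  then show thesis by (intro that[of id]) (auto simp: strict_mono_def uniform_limit_iff)
next
  case False
  then obtain w where w: "w \<in> S" by auto
  define G where "G k z = (F k z - a) / (b - a)" for k z
  have holG: "G k holomorphic_on S" for k
    unfolding G_def by (intro holomorphic_intros hol) (use ab in auto)
  have G01: "G k z \<noteq> 0 \<and> G k z \<noteq> 1" if "z \<in> S" for k z
    using ab that by (auto simp: G_def divide_eq_1_iff)
  have FG: "F k z = a + (b - a) * G k z" for k z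
    using ab(1) by (simp add: G_def)
  have Feq: "F = (\<lambda>k z. a + (b - a) * G k z)" by (intro ext FG)
  \<comment> \<open>Functions omitting 0 and 1 with modulus at most 1 at \<open>w\<close> are
    uniformly bounded on compact sets by Schottky's theorem, so the locally bounded form of Montel's
    theorem applies to them.\<close>
  have sub: "\<exists>h s. h holomorphic_on S \<and> strict_mono (s :: nat \<Rightarrow> nat) \<and>
      (\<forall>K. compact K \<and> K \<subseteq> S \<longrightarrow> uniform_limit K (H \<circ> s) h sequentially)"
    if H: "\<And>k. H k holomorphic_on S" "\<And>k z. z \<in> S \<Longrightarrow> H k z \<noteq> 0 \<and> H k z \<noteq> 1" "\<And>k. norm (H k w) \<le> 1"
    for H :: "nat \<Rightarrow> complex \<Rightarrow> complex"
  proof -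
    have bd: "\<exists>B. \<forall>h\<in>range H. \<forall>z\<in>K. norm (h z) \<le> B" if K: "compact K" "K \<subseteq> S" for K
    proof -
      obtain B where "\<And>h z. h \<in> range H \<Longrightarrow> z \<in> K \<Longrightarrow> norm (h z) \<le> B"
        by (rule GPicard3[OF S w subset_refl, of "range H" K]) (use H K in auto)
      then show ?thesis by blast
    qed
    have mem: "h holomorphic_on S" if "h \<in> range H" for h
      using that H(1) by auto
    show ?thesis
    proof (rule Montel[OF S(1) mem bd subset_refl])
      fix h and s :: "nat \<Rightarrow> nat"
      assume "h holomorphic_on S" "strict_mono s"
        and lim: "\<And>K. compact K \<Longrightarrow> K \<subseteq> S \<Longrightarrow> uniform_limit K (H \<circ> s) h sequentially"
      then show ?thesis by (intro exI[of _ h] exI[of _ s] conjI allI impI lim) auto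
    qed auto
  qed
  show thesis
  proof (cases "infinite {k. norm (G k w) \<le> 1}")
    case True
    obtain s :: "nat \<Rightarrow> nat" where s: "strict_mono s" "\<And>n. norm (G (s n) w) \<le> 1"
      using infinite_enumerate[OF True] by fast
    obtain h t where h: "strict_mono (t :: nat \<Rightarrow> nat)"
      "\<And>K. compact K \<Longrightarrow> K \<subseteq> S \<Longrightarrow> uniform_limit K ((\<lambda>k. G (s k)) \<circ> t) h sequentially"
      using sub[of "\<lambda>k. G (s k)", OF holG G01 s(2)] by blast
    have "uniform_limit K (F \<circ> (s \<circ> t)) (\<lambda>z. a + (b - a) * h z) sequentially" if "compact K" "K \<subseteq> S" for K
    proof -
      have "uniform_limit K (\<lambda>k z. a + (b - a) * ((\<lambda>k. G (s k)) \<circ> t) k z) (\<lambda>z. a + (b - a) * h z) sequentially"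
        by (intro uniform_limit_add uniform_limit_const bounded_linear.uniform_limit[OF bounded_linear_mult_right] h that)
      then show ?thesis by (simp add: Feq o_def)
    qed
    then show thesis
      by (intro that[of "s \<circ> t"] disjI1 strict_mono_o[OF s(1) h(1)]) blast
  next
    case False
    have "{k. norm (G k w) > 1} = - {k. norm (G k w) \<le> 1}" by auto
    with False have inf: "infinite {k. norm (G k w) > 1}"
      by (simp only:) (use finite_compl infinite_UNIV_nat in blast)
    obtain s :: "nat \<Rightarrow> nat" where s: "strict_mono s" "\<And>n. norm (G (s n) w) > 1"
      using infinite_enumerate[OF inf] by fast
    \<comment> \<open>The reciprocals also omit 0 and 1 and are small at \<open>w\<close>. By
      Hurwitz's theorem their limit is either identically zero, and then \<open>F\<close> tends to
      infinity, or free of zeros, and then the reciprocals can be inverted back.\<close>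
    define H where "H k z = inverse (G (s k) z)" for k z
    have holH: "H k holomorphic_on S" for k
      unfolding H_def by (intro holomorphic_intros holG) (use G01 in auto)
    have H01: "H k z \<noteq> 0 \<and> H k z \<noteq> 1" if "z \<in> S" for k z
      using G01[OF that, of "s k"] by (auto simp: H_def inverse_eq_1_iff)
    have Hw: "norm (H k w) \<le> 1" for k
      using less_imp_le[OF s(2)[of k]] by (simp add: H_def norm_inverse inverse_le_1_iff)
    obtain h t where h: "h holomorphic_on S" "strict_mono (t :: nat \<Rightarrow> nat)"
      "\<And>K. compact K \<Longrightarrow> K \<subseteq> S \<Longrightarrow> uniform_limit K (H \<circ> t) h sequentially"
      using sub[of H, OF holH H01 Hw] by blast
    have st: "strict_mono (s \<circ> t)" using s(1) h(2) by (rule strict_mono_o)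
    have GH: "G (s k) z = inverse (H k z)" for k z by (simp add: H_def)
    show thesis
    proof (cases "\<forall>z\<in>S. h z = 0")
      case True
      have "\<forall>\<^sub>F k in sequentially. \<forall>z\<in>K. B \<le> norm (F ((s \<circ> t) k) z)" if K: "compact K" "K \<subseteq> S" for K B
      proof -
        \<comment> \<open>Chosen so that \<open>norm (G k z) > C\<close> forces
          \<open>norm (F k z)\<close> to be at least \<open>B\<close>.\<close>
        define C where "C = (\<bar>B\<bar> + norm a + 1) / norm (b - a)"
        have C: "0 < C" "norm (b - a) * C = \<bar>B\<bar> + norm a + 1" using ab(1) by (auto simp: C_def add_nonneg_pos)
        have "\<forall>\<^sub>F k in sequentially. \<forall>z\<in>K. dist ((H \<circ> t) k z) (h z) < inverse C"
          using h(3)[OF K] C(1) unfolding uniform_limit_iff by auto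
        then show ?thesis
        proof eventually_elim
          case (elim k)
          show ?case
          proof
            fix z assume z: "z \<in> K"
            then have "norm (H (t k) z) < inverse C" using elim True K by force
            moreover have "0 < norm (H (t k) z)" using H01 z K by auto
            ultimately have "C < norm (G (s (t k)) z)"
              unfolding GH norm_inverse using C(1) by (metis inverse_inverse_eq less_imp_inverse_less)
            then have "norm (b - a) * C \<le> norm (b - a) * norm (G (s (t k)) z)"
              by (intro mult_left_mono) auto
            also have "\<dots> = norm (F (s (t k)) z - a)" by (simp add: FG norm_mult)
            also have "\<dots> \<le> norm (F (s (t k)) z) + norm a" by (rule norm_triangle_ineq4)
            finally show "B \<le> norm (F ((s \<circ> t) k) z)" using C(2) by simp
          qed
        qed
      qed
      then show thesis by (intro that[OF st] disjI2) blast
    next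
      case False
      then obtain z0 where z0: "z0 \<in> S" "h z0 \<noteq> 0" by auto
      have nz: "h z \<noteq> 0" if "z \<in> S" for z
      proof (cases "h constant_on S")
        case True
        then show ?thesis using z0 that by (metis constant_on_def)
      next
        case False
        show ?thesis
          by (rule Hurwitz_no_zeros[OF S, of "H \<circ> t" h]) (use holH H01 h False that in auto)
      qed
      have "uniform_limit K (F \<circ> (s \<circ> t)) (\<lambda>z. a + (b - a) * inverse (h z)) sequentially"
        if K: "compact K" "K \<subseteq> S" for K
      proof -
        have ch: "continuous_on K (\<lambda>z. norm (h z))"
          using h(1) K by (intro continuous_intros holomorphic_on_imp_continuous_on) (auto intro: holomorphic_on_subset)
        obtain c where c: "0 < c" "\<And>z. z \<in> K \<Longrightarrow> c \<le> norm (h z)"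
        proof (cases "K = {}")
          case True then show thesis using that[of 1] by auto
        next
          case False
          then obtain x where "x \<in> K" "\<forall>y\<in>K. norm (h x) \<le> norm (h y)"
            using continuous_attains_inf[OF K(1) _ ch] by auto
          then show thesis using that[of "norm (h x)"] nz K by auto
        qed
        have "uniform_limit K (\<lambda>k z. a + (b - a) * inverse ((H \<circ> t) k z)) (\<lambda>z. a + (b - a) * (inverse \<circ> h) z) sequentially"
          by (intro uniform_limit_add uniform_limit_const bounded_linear.uniform_limit[OF bounded_linear_mult_right]
              uniform_lim_inverse[OF h(3)[OF K] c(2) c(1)])
        then show ?thesis by (simp add: Feq GH o_def)
      qed
      then show thesis by (intro that[OF st] disjI1) blast
    qed
  qed
qed

lemma transcendental_entireD:
  assumes "transcendental_entire f"
  shows "f holomorphic_on UNIV" "\<not> f constant_on UNIV"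
proof -
  show "f holomorphic_on UNIV"
    using assms by (simp add: transcendental_entire_def)
  show "\<not> f constant_on UNIV"
  proof
    assume "f constant_on UNIV"
    then obtain c where "\<And>z. f z = poly [:c:] z" by (auto simp: constant_on_def)
    then show False using assms unfolding transcendental_entire_def by blast
  qed
qed

text \<open>Infinity is an essential singularity: Liouville's theorem excludes a finite limit and a
  pole would make \<open>f\<close> a polynomial. Great Picard, applied at 0 after an inversion,
  leaves a single possible exception \<open>a\<close>.\<close>

lemma transcendental_infinite_preimage:
  assumes "transcendental_entire f"
  obtains a where "\<And>w. w \<noteq> a \<Longrightarrow> infinite (f -` {w})"
proof -
  note hol = transcendental_entireD(1)[OF assms]
  have poly: False if "\<And>z. f z = (\<Sum>i\<le>n. c i * z ^ i)" for c n
  proof -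
    have "f z = poly (\<Sum>i\<le>n. monom (c i) i) z" for z
      by (simp add: that poly_sum poly_monom)
    then show False using assms by (auto simp: transcendental_entire_def)
  qed
  have 1: "\<not> ((f \<circ> inverse) \<longlongrightarrow> l) (at 0)" for l
  proof
    assume "((f \<circ> inverse) \<longlongrightarrow> l) (at 0)"
    then have "(f \<longlongrightarrow> l) at_infinity" by (simp add: lim_at_infinity_0)
    then have "f z = l" for z using Liouville_weak[OF hol] by blast
    then show False using transcendental_entireD(2)[OF assms] by (auto simp: constant_on_def)
  qed
  have 2: "\<not> ((inverse \<circ> (f \<circ> inverse)) \<longlongrightarrow> l) (at 0)" for l
  proof
    assume "((inverse \<circ> (f \<circ> inverse)) \<longlongrightarrow> l) (at 0)"
    then have "((inverse \<circ> f) \<longlongrightarrow> l) at_infinity" by (simp add: lim_at_infinity_0 o_assoc)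
    then show False using pole_at_infinity[OF hol] poly by metis
  qed
  have "(f \<circ> inverse) holomorphic_on (UNIV - {0})"
    using hol by (intro holomorphic_on_compose holomorphic_intros) (auto intro: holomorphic_on_subset)
  then obtain a where a: "\<And>w. w \<noteq> a \<Longrightarrow> infinite {x. x \<in> UNIV - {0} \<and> (f \<circ> inverse) x = w}"
    using great_Picard_infinite[OF open_UNIV UNIV_I _ 1 2] by metis
  show thesis
  proof (rule that)
    fix w assume "w \<noteq> a"
    moreover have "inverse ` {x. x \<in> UNIV - {0} \<and> (f \<circ> inverse) x = w} \<subseteq> f -` {w}" by auto
    moreover have "inj_on inverse {x. x \<in> UNIV - {0} \<and> (f \<circ> inverse) x = w}"
      by (auto simp: inj_on_def)
    ultimately show "infinite (f -` {w})"
      using a[of w] finite_imageD finite_subset by blast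
  qed
qed

subsection \<open>Fatou and Julia sets\<close>

lemma holomorphic_on_funpow:
  assumes "f holomorphic_on UNIV"
  shows "(f ^^ n) holomorphic_on UNIV"
proof (induction n)
  case (Suc n)
  then show ?case
    using holomorphic_on_compose[OF Suc] holomorphic_on_subset[OF assms] by (simp add: o_def)
qed (simp add: id_def)

lemma continuous_on_funpow_holomorphic:
  assumes "f holomorphic_on UNIV"
  shows "continuous_on S (f ^^ n)"
  using holomorphic_on_funpow[OF assms] holomorphic_on_imp_continuous_on continuous_on_subset by blast

lemma open_image_funpow:
  assumes "transcendental_entire f" "open S"
  shows "open ((f ^^ n) ` S)"
proof (induction n)
  case (Suc n)
  have "open (f ` ((f ^^ n) ` S))"
    using transcendental_entireD[OF assms(1)] Suc
    by (intro open_mapping_thm[of f UNIV]) auto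
  then show ?case by (simp add: image_comp)
qed (simp add: assms)

lemma funpow_not_constant:
  assumes "transcendental_entire f"
  shows "\<not> (f ^^ n) constant_on UNIV"
proof
  assume "(f ^^ n) constant_on UNIV"
  then obtain c where "(f ^^ n) ` UNIV = {c}" by (auto simp: constant_on_def)
  then show False using open_image_funpow[OF assms open_UNIV, of n] by (metis not_open_singleton)
qed

lemma open_fatou_set: "open (fatou_set f)"
proof (subst open_subopen, intro ballI)
  fix z assume "z \<in> fatou_set f"
  then obtain U where U: "open U" "connected U" "z \<in> U" "normal_on U (range (\<lambda>n. f ^^ n))"
    by (auto simp: fatou_set_def)
  then have "U \<subseteq> fatou_set f" by (auto simp: fatou_set_def)
  with U show "\<exists>T. open T \<and> z \<in> T \<and> T \<subseteq> fatou_set f" by blast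
qed

lemma closed_julia_set: "closed (julia_set f)"
  by (simp add: julia_set_def open_fatou_set closed_Compl)

lemma fatou_set_image:
  assumes "transcendental_entire f" "z \<in> fatou_set f"
  shows "f z \<in> fatou_set f"
proof -
  obtain U where U: "open U" "z \<in> U" and norm: "normal_on U (range (\<lambda>n. f ^^ n))"
    using assms(2) by (auto simp: fatou_set_def)
  obtain \<rho> where \<rho>: "0 < \<rho>" "cball z \<rho> \<subseteq> U"
    using U open_contains_cball by metis
  define V where "V = f ` ball z \<rho>"
  have hol: "f holomorphic_on UNIV" using transcendental_entireD[OF assms(1)] by blast
  have "open V" using open_image_funpow[OF assms(1), of "ball z \<rho>" 1] by (simp add: V_def)
  moreover have "connected V"
    unfolding V_def by (intro connected_continuous_image holomorphic_on_imp_continuous_on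
        holomorphic_on_subset[OF hol]) auto
  moreover have "f z \<in> V" using \<rho> by (auto simp: V_def)
  moreover have "normal_on V (range (\<lambda>n. f ^^ n))"
    unfolding normal_on_def
  proof (intro allI impI)
    fix g :: "nat \<Rightarrow> complex \<Rightarrow> complex" assume "range g \<subseteq> range (\<lambda>n. f ^^ n)"
    then have "\<forall>k. \<exists>n. g k = f ^^ n" by auto
    then obtain n where n: "\<And>k. g k = f ^^ n k" by metis
    define g' where "g' k = f ^^ Suc (n k)" for k
    have "range g' \<subseteq> range (\<lambda>n. f ^^ n)" unfolding g'_def by blast
    then obtain r where r: "strict_mono r" and lim:
       "(\<exists>h. \<forall>K. compact K \<and> K \<subseteq> U \<longrightarrow> uniform_limit K (g' \<circ> r) h sequentially) \<or>
        (\<forall>K. compact K \<and> K \<subseteq> U \<longrightarrow> (\<forall>B :: real. \<forall>\<^sub>F k in sequentially. \<forall>z\<in>K. B \<le> norm (g' (r k) z)))"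
      using norm unfolding normal_on_def by blast
    \<comment> \<open>A section of \<open>f\<close> over \<open>V\<close> with values in a compact
      disc, which turns \<open>f ^^ n\<close> at \<open>v\<close> into \<open>f ^^ Suc n\<close> at
      \<open>p v\<close>. It need not be continuous: uniform convergence on the disc transfers to
      all of \<open>V\<close> at once.\<close>
    define p where "p v = (SOME x. x \<in> cball z \<rho> \<and> f x = v)" for v
    have p: "p v \<in> cball z \<rho> \<and> f (p v) = v" if "v \<in> V" for v
    proof -
      have "\<exists>x. x \<in> cball z \<rho> \<and> f x = v" using that by (force simp: V_def)
      then show ?thesis unfolding p_def by (rule someI_ex)
    qed
    have g: "g k v = g' k (p v)" if "v \<in> V" for k v
      using p[OF that] by (simp add: n g'_def funpow_swap1)
    from lim show "\<exists>r. strict_mono r \<and>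
       ((\<exists>h. \<forall>K. compact K \<and> K \<subseteq> V \<longrightarrow> uniform_limit K (g \<circ> r) h sequentially) \<or>
        (\<forall>K. compact K \<and> K \<subseteq> V \<longrightarrow> (\<forall>B :: real. \<forall>\<^sub>F k in sequentially. \<forall>z\<in>K. B \<le> norm (g (r k) z))))"
    proof (elim disjE exE)
      fix h assume h: "\<forall>K. compact K \<and> K \<subseteq> U \<longrightarrow> uniform_limit K (g' \<circ> r) h sequentially"
      then have lim: "uniform_limit (cball z \<rho>) (g' \<circ> r) h sequentially" using \<rho> by auto
      have "uniform_limit K (g \<circ> r) (h \<circ> p) sequentially" if K: "compact K" "K \<subseteq> V" for K
        unfolding uniform_limit_iff
      proof (intro allI impI)
        fix e :: real assume "0 < e"
        with lim have "\<forall>\<^sub>F k in sequentially. \<forall>x\<in>cball z \<rho>. dist ((g' \<circ> r) k x) (h x) < e"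
          by (auto simp: uniform_limit_iff)
        then show "\<forall>\<^sub>F k in sequentially. \<forall>x\<in>K. dist ((g \<circ> r) k x) ((h \<circ> p) x) < e"
        proof eventually_elim
          case (elim k)
          show ?case
          proof
            fix x assume "x \<in> K"
            then have "x \<in> V" using K by auto
            then show "dist ((g \<circ> r) k x) ((h \<circ> p) x) < e" using elim p g by simp
          qed
        qed
      qed
      then show ?thesis using r by blast
    next
      assume lim: "\<forall>K. compact K \<and> K \<subseteq> U \<longrightarrow> (\<forall>B :: real. \<forall>\<^sub>F k in sequentially. \<forall>z\<in>K. B \<le> norm (g' (r k) z))"
      have "\<forall>\<^sub>F k in sequentially. \<forall>z\<in>K. B \<le> norm (g (r k) z)" if K: "compact K" "K \<subseteq> V" for K B
      proof -
        have "\<forall>\<^sub>F k in sequentially. \<forall>x\<in>cball z \<rho>. B \<le> norm (g' (r k) x)" using lim \<rho> by auto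
        then show ?thesis
        proof eventually_elim
          case (elim k)
          show ?case
          proof
            fix x assume "x \<in> K"
            then have "x \<in> V" using K by auto
            then show "B \<le> norm (g (r k) x)" using elim p g by simp
          qed
        qed
      qed
      then show ?thesis using r by blast
    qed
  qed
  ultimately show ?thesis unfolding fatou_set_def by blast
qed

lemma fatou_set_preimage:
  assumes "f holomorphic_on UNIV" "f z \<in> fatou_set f"
  shows "z \<in> fatou_set f"
proof -
  obtain U where U: "open U" "f z \<in> U" and norm: "normal_on U (range (\<lambda>n. f ^^ n))"
    using assms(2) by (auto simp: fatou_set_def)
  have cf: "continuous_on S f" for S
    using assms(1) holomorphic_on_imp_continuous_on continuous_on_subset by blast
  have "open (f -` U)" using continuous_open_preimage[OF cf[of UNIV] open_UNIV U(1)] by simp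
  then obtain \<rho> where \<rho>: "0 < \<rho>" "ball z \<rho> \<subseteq> f -` U"
    using U(2) by (auto elim: openE)
  have "normal_on (ball z \<rho>) (range (\<lambda>n. f ^^ n))"
    unfolding normal_on_def
  proof (intro allI impI)
    fix g :: "nat \<Rightarrow> complex \<Rightarrow> complex" assume "range g \<subseteq> range (\<lambda>n. f ^^ n)"
    then have "\<forall>k. \<exists>n. g k = f ^^ n" by auto
    then obtain n where n: "\<And>k. g k = f ^^ n k" by metis
    let ?goal = "\<exists>r. strict_mono r \<and>
       ((\<exists>h. \<forall>K. compact K \<and> K \<subseteq> ball z \<rho> \<longrightarrow> uniform_limit K (g \<circ> r) h sequentially) \<or>
        (\<forall>K. compact K \<and> K \<subseteq> ball z \<rho> \<longrightarrow> (\<forall>B :: real. \<forall>\<^sub>F k in sequentially. \<forall>z\<in>K. B \<le> norm (g (r k) z))))"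
    \<comment> \<open>The identity does not factor through \<open>f\<close>. Either it recurs
      infinitely often and gives a constant subsequence, or the truncated difference
      \<open>n k - 1\<close> is the true predecessor for all but finitely many
      \<open>k\<close>.\<close>
    show ?goal
    proof (cases "infinite {k. n k = 0}")
      case True
      obtain r :: "nat \<Rightarrow> nat" where r: "strict_mono r" "\<And>k. n (r k) = 0"
        using infinite_enumerate[OF True] by fast
      then have "uniform_limit K (g \<circ> r) id sequentially" for K
        by (auto simp: uniform_limit_iff n)
      then show ?thesis using r(1) by blast
    next
      case False
      define g' where "g' k = f ^^ (n k - 1)" for k
      have "range g' \<subseteq> range (\<lambda>n. f ^^ n)" unfolding g'_def by blast
      then obtain r where r: "strict_mono r" and lim:
         "(\<exists>h. \<forall>K. compact K \<and> K \<subseteq> U \<longrightarrow> uniform_limit K (g' \<circ> r) h sequentially) \<or>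
          (\<forall>K. compact K \<and> K \<subseteq> U \<longrightarrow> (\<forall>B :: real. \<forall>\<^sub>F k in sequentially. \<forall>z\<in>K. B \<le> norm (g' (r k) z)))"
        using norm unfolding normal_on_def by blast
      have "\<forall>\<^sub>F k in sequentially. n k \<noteq> 0"
        using False by (simp add: eventually_cofinite flip: cofinite_eq_sequentially)
      then have "\<forall>\<^sub>F k in sequentially. n (r k) \<noteq> 0"
        by (rule eventually_subseq[OF r])
      then have ev: "\<forall>\<^sub>F k in sequentially. \<forall>x. g (r k) x = g' (r k) (f x)"
      proof eventually_elim
        case (elim k)
        then have "n (r k) = Suc (n (r k) - 1)" by simp
        then show ?case by (metis comp_apply funpow_Suc_right g'_def n)
      qed
      have fK: "compact (f ` K)" "f ` K \<subseteq> U" if "compact K" "K \<subseteq> ball z \<rho>" for K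
        using that \<rho> by (auto intro: compact_continuous_image cf)
      from lim show ?thesis
      proof (elim disjE exE)
        fix h assume h: "\<forall>K. compact K \<and> K \<subseteq> U \<longrightarrow> uniform_limit K (g' \<circ> r) h sequentially"
        have "uniform_limit K (g \<circ> r) (h \<circ> f) sequentially" if K: "compact K" "K \<subseteq> ball z \<rho>" for K
          unfolding uniform_limit_iff
        proof (intro allI impI)
          fix e :: real assume "0 < e"
          then have "\<forall>\<^sub>F k in sequentially. \<forall>x\<in>f ` K. dist ((g' \<circ> r) k x) (h x) < e"
            using h fK[OF K] by (auto simp: uniform_limit_iff)
          with ev show "\<forall>\<^sub>F k in sequentially. \<forall>x\<in>K. dist ((g \<circ> r) k x) ((h \<circ> f) x) < e"
            by eventually_elim auto
        qed
        then show ?thesis using r by blast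
      next
        assume lim: "\<forall>K. compact K \<and> K \<subseteq> U \<longrightarrow> (\<forall>B :: real. \<forall>\<^sub>F k in sequentially. \<forall>z\<in>K. B \<le> norm (g' (r k) z))"
        have "\<forall>\<^sub>F k in sequentially. \<forall>z\<in>K. B \<le> norm (g (r k) z)" if K: "compact K" "K \<subseteq> ball z \<rho>" for K B
        proof -
          have "\<forall>\<^sub>F k in sequentially. \<forall>x\<in>f ` K. B \<le> norm (g' (r k) x)" using lim fK[OF K] by blast
          with ev show ?thesis by eventually_elim auto
        qed
        then show ?thesis using r by blast
      qed
    qed
  qed
  then show ?thesis unfolding fatou_set_def using \<rho>(1) centre_in_ball connected_ball open_ball by blast
qed

lemma julia_set_iff:
  assumes "transcendental_entire f"
  shows "(f ^^ n) z \<in> julia_set f \<longleftrightarrow> z \<in> julia_set f"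
proof (induction n)
  case (Suc n)
  have "f w \<in> julia_set f \<longleftrightarrow> w \<in> julia_set f" for w
    using fatou_set_image[OF assms] fatou_set_preimage[OF transcendental_entireD(1)[OF assms]]
    unfolding julia_set_def by blast
  then show ?case using Suc by simp
qed simp

text \<open>By Montel's theorem a non-normal sequence of iterates cannot omit two fixed values. The
  omitted pair may change with \<open>n\<close>, but \<open>S\<close> is finite, so one pair recurs
  along a subsequence of a sequence that violates normality. Some image of \<open>N\<close> thus
  misses at most one point of \<open>S\<close>.\<close>

lemma julia_set_blow_up:
  assumes te: "transcendental_entire f" and z: "z \<in> julia_set f" "open N" "connected N" "z \<in> N"
    and "finite S"
  obtains n where "\<And>a b. a \<in> S \<Longrightarrow> b \<in> S \<Longrightarrow> a \<noteq> b \<Longrightarrow> a \<in> (f ^^ n) ` N \<or> b \<in> (f ^^ n) ` N"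
proof (rule ccontr)
  assume "\<not> thesis"
  have "\<exists>p. p \<in> S \<times> S \<and> fst p \<noteq> snd p \<and> fst p \<notin> (f ^^ n) ` N \<and> snd p \<notin> (f ^^ n) ` N" for n
  proof (rule ccontr)
    assume "\<not> ?thesis"
    then have "a \<in> (f ^^ n) ` N \<or> b \<in> (f ^^ n) ` N" if "a \<in> S" "b \<in> S" "a \<noteq> b" for a b
      using that by auto
    with \<open>\<not> thesis\<close> that[of n] show False by blast
  qed
  then obtain p where "\<forall>n. p n \<in> S \<times> S \<and> fst (p n) \<noteq> snd (p n) \<and>
     fst (p n) \<notin> (f ^^ n) ` N \<and> snd (p n) \<notin> (f ^^ n) ` N"
    by metis
  then have p: "p n \<in> S \<times> S" "fst (p n) \<noteq> snd (p n)"
     "fst (p n) \<notin> (f ^^ n) ` N" "snd (p n) \<notin> (f ^^ n) ` N" for n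
    by auto
  have "\<not> normal_on N (range (\<lambda>n. f ^^ n))"
    using z unfolding julia_set_def fatou_set_def by auto
  then obtain g :: "nat \<Rightarrow> complex \<Rightarrow> complex" where g: "range g \<subseteq> range (\<lambda>n. f ^^ n)"
    and no: "\<And>r. strict_mono r \<Longrightarrow>
        \<not> ((\<exists>h. \<forall>K. compact K \<and> K \<subseteq> N \<longrightarrow> uniform_limit K (g \<circ> r) h sequentially) \<or>
          (\<forall>K. compact K \<and> K \<subseteq> N \<longrightarrow> (\<forall>B :: real. \<forall>\<^sub>F k in sequentially. \<forall>z\<in>K. B \<le> norm (g (r k) z))))"
    unfolding normal_on_def by blast
  from g have "\<forall>k. \<exists>n. g k = f ^^ n" by auto
  then obtain n where n: "\<And>k. g k = f ^^ n k" by metis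
  have "finite ((\<lambda>k. p (n k)) ` UNIV)"
    by (rule finite_subset[OF _ finite_cartesian_product[OF assms(6) assms(6)]]) (simp add: image_subset_iff p(1))
  then obtain k0 where k0: "infinite {k \<in> UNIV. p (n k) = p (n k0)}"
    using pigeonhole_infinite[OF infinite_UNIV_nat, of "\<lambda>k. p (n k)"] by blast
  obtain s :: "nat \<Rightarrow> nat" where s: "strict_mono s" "\<And>k. p (n (s k)) = p (n k0)"
    using infinite_enumerate[OF k0] by fast
  have omit: "g (s k) z \<noteq> fst (p (n k0)) \<and> g (s k) z \<noteq> snd (p (n k0))" if "z \<in> N" for k z
    using p(3,4)[of "n (s k)"] that unfolding s(2) n by (metis imageI)
  have hol: "g (s k) holomorphic_on N" for k
    unfolding n using holomorphic_on_funpow[OF transcendental_entireD(1)[OF te]] holomorphic_on_subset by blast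
  obtain r where r: "strict_mono r"
    "(\<exists>h. \<forall>K. compact K \<and> K \<subseteq> N \<longrightarrow> uniform_limit K ((\<lambda>k. g (s k)) \<circ> r) h sequentially) \<or>
     (\<forall>K. compact K \<and> K \<subseteq> N \<longrightarrow> (\<forall>B :: real. \<forall>\<^sub>F k in sequentially. \<forall>z\<in>K. B \<le> norm (g (s (r k)) z)))"
    by (rule montel_omitting_two_values[OF z(2,3) hol p(2)[of "n k0"] omit])
  show False
    using no[OF strict_mono_o[OF s(1) r(1)]] r(2) unfolding o_def by (rule notE)
qed

text \<open>A bounded orbit in \<open>U\<close> excludes divergence to infinity, so subsequences
  have finite limits, uniformly on \<open>K\<close>; uniformity matters because the points where a
  bound fails may move with the iterate.\<close>

lemma normal_on_bounded_orbit:
  assumes "f holomorphic_on UNIV" and norm: "normal_on U (range (\<lambda>n. f ^^ n))"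
    and u: "u \<in> U" "\<And>n. norm ((f ^^ n) u) \<le> C" and K: "compact K" "K \<subseteq> U"
  obtains B where "\<And>n x. x \<in> K \<Longrightarrow> norm ((f ^^ n) x) \<le> B"
proof (rule ccontr)
  assume no: "\<not> thesis"
  have "\<exists>n x. x \<in> K \<and> norm ((f ^^ n) x) > real j" for j
    using no that[of "real j"] by (metis not_le)
  then obtain n x where nx: "\<And>j. x j \<in> K" "\<And>j. norm ((f ^^ n j) (x j)) > real j"
    by metis
  define g where "g j = f ^^ n j" for j
  have "range g \<subseteq> range (\<lambda>n. f ^^ n)" unfolding g_def by blast
  then obtain r where r: "strict_mono r" and lim:
       "(\<exists>h. \<forall>K. compact K \<and> K \<subseteq> U \<longrightarrow> uniform_limit K (g \<circ> r) h sequentially) \<or>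
        (\<forall>K. compact K \<and> K \<subseteq> U \<longrightarrow> (\<forall>B :: real. \<forall>\<^sub>F k in sequentially. \<forall>z\<in>K. B \<le> norm (g (r k) z)))"
    using norm unfolding normal_on_def by blast
  from lim show False
  proof (elim disjE exE)
    fix h assume "\<forall>K. compact K \<and> K \<subseteq> U \<longrightarrow> uniform_limit K (g \<circ> r) h sequentially"
    then have "uniform_limit K (g \<circ> r) h sequentially" using K by blast
    then have "\<forall>\<^sub>F k in sequentially. \<forall>x\<in>K. dist (g (r k) x) (h x) < 1"
      by (simp add: uniform_limit_iff)
    \<comment> \<open>\<open>h\<close> is not known to be bounded. It only serves to compare all
      later members with \<open>g (r k0)\<close>, which is bounded on \<open>K\<close> by
      continuity.\<close>
    then obtain k0 where k0: "\<And>k x. k \<ge> k0 \<Longrightarrow> x \<in> K \<Longrightarrow> dist (g (r k) x) (h x) < 1"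
      by (auto simp: eventually_sequentially)
    have "compact (g (r k0) ` K)"
      unfolding g_def by (intro compact_continuous_image continuous_on_funpow_holomorphic assms K)
    then obtain M where M: "\<And>x. x \<in> K \<Longrightarrow> norm (g (r k0) x) \<le> M"
      by (meson bounded_iff compact_imp_bounded imageI)
    define k where "k = max k0 (nat \<lceil>M + 2\<rceil>)"
    have "norm (g (r k) (x (r k))) \<le> norm (g (r k0) (x (r k))) + dist (g (r k0) (x (r k))) (g (r k) (x (r k)))"
      by norm
    also have "\<dots> \<le> M + (dist (g (r k0) (x (r k))) (h (x (r k))) + dist (g (r k) (x (r k))) (h (x (r k))))"
      by (intro add_mono M nx dist_triangle2)
    also have "\<dots> < M + (1 + 1)"
      by (intro add_strict_left_mono add_strict_mono k0 nx) (auto simp: k_def)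
    also have "\<dots> \<le> real k" unfolding k_def by linarith
    also have "\<dots> \<le> real (r k)" using seq_suble[OF r] by simp
    finally show False using nx(2)[of "r k"] by (simp add: g_def)
  next
    assume "\<forall>K. compact K \<and> K \<subseteq> U \<longrightarrow> (\<forall>B :: real. \<forall>\<^sub>F k in sequentially. \<forall>z\<in>K. B \<le> norm (g (r k) z))"
    moreover have "compact {u}" "{u} \<subseteq> U" using u(1) by auto
    ultimately have "\<forall>\<^sub>F k in sequentially. \<forall>z\<in>{u}. C + 1 \<le> norm (g (r k) z)"
      by blast
    then obtain k where "C + 1 \<le> norm (g (r k) u)" by (auto simp: eventually_sequentially)
    then show False using u(2)[of "n (r k)"] by (simp add: g_def)
  qed
qed

text \<open>Boundedness of the orbit passes between points of a common set of normality, hence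
  through the connected \<open>G\<close>; a finite subcover of \<open>K\<close> makes the bound
  uniform.\<close>

lemma fatou_connected_bounded_orbits:
  assumes hol: "f holomorphic_on UNIV" and G: "connected G" "G \<subseteq> fatou_set f"
    and u: "u \<in> G" "\<And>n. norm ((f ^^ n) u) \<le> C" and K: "compact K" "K \<subseteq> G"
  obtains B where "\<And>n x. x \<in> K \<Longrightarrow> norm ((f ^^ n) x) \<le> B"
proof -
  have orb: "\<exists>B. \<forall>n. norm ((f ^^ n) v) \<le> B" if "v \<in> G" for v
  proof (rule connected_induction_simple[OF G(1) u(1) that, where P = "\<lambda>v. \<exists>B. \<forall>n. norm ((f ^^ n) v) \<le> B"])
    show "\<exists>B. \<forall>n. norm ((f ^^ n) u) \<le> B" using u(2) by blast
    fix a assume "a \<in> G"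
    then obtain U where U: "open U" "a \<in> U" "normal_on U (range (\<lambda>n. f ^^ n))"
      using G(2) by (auto simp: fatou_set_def)
    have "\<exists>B. \<forall>n. norm ((f ^^ n) y) \<le> B" if xy: "x \<in> U" "y \<in> U" and B: "\<forall>n. norm ((f ^^ n) x) \<le> B" for x y B
    proof -
      obtain B' where "\<And>n x. x \<in> {y} \<Longrightarrow> norm ((f ^^ n) x) \<le> B'"
        by (rule normal_on_bounded_orbit[OF hol U(3) xy(1) B[rule_format], of "{y}"]) (use xy in auto)
      then show ?thesis by blast
    qed
    then show "\<exists>T. openin (top_of_set G) T \<and> a \<in> T \<and> (\<forall>x\<in>T. \<forall>y\<in>T.
        (\<exists>B. \<forall>n. norm ((f ^^ n) x) \<le> B) \<longrightarrow> (\<exists>B. \<forall>n. norm ((f ^^ n) y) \<le> B))"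
      using U \<open>a \<in> G\<close> by (intro exI[of _ "G \<inter> U"]) (auto simp: openin_open_Int)
  qed
  have "\<exists>T B. open T \<and> v \<in> T \<and> (\<forall>n. \<forall>x\<in>T. norm ((f ^^ n) x) \<le> B)" if v: "v \<in> K" for v
  proof -
    obtain U where U: "open U" "v \<in> U" "normal_on U (range (\<lambda>n. f ^^ n))"
      using G(2) K(2) v by (auto simp: fatou_set_def)
    obtain \<rho> where \<rho>: "0 < \<rho>" "cball v \<rho> \<subseteq> U" using U open_contains_cball by metis
    obtain C where C: "\<And>n. norm ((f ^^ n) v) \<le> C" using orb v K by blast
    obtain B where "\<And>n x. x \<in> cball v \<rho> \<Longrightarrow> norm ((f ^^ n) x) \<le> B"
      by (rule normal_on_bounded_orbit[OF hol U(3,2) C, of "cball v \<rho>"]) (use \<rho> in auto)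
    then show ?thesis using \<rho>(1) by (intro exI[of _ "ball v \<rho>"] exI[of _ B]) auto
  qed
  then obtain T B where TB: "\<And>v. v \<in> K \<Longrightarrow> open (T v) \<and> v \<in> T v"
    "\<And>v n x. v \<in> K \<Longrightarrow> x \<in> T v \<Longrightarrow> norm ((f ^^ n) x) \<le> B v"
    by metis
  obtain D where D: "D \<subseteq> K" "finite D" "K \<subseteq> (\<Union>v\<in>D. T v)"
    by (rule compactE_image[OF K(1), of K T]) (use TB(1) in auto)
  have "norm ((f ^^ n) x) \<le> Max (B ` D)" if "x \<in> K" for n x
  proof -
    obtain v where v: "v \<in> D" "x \<in> T v" using D(3) \<open>x \<in> K\<close> by auto
    then have "norm ((f ^^ n) x) \<le> B v" using TB(2)[of v x n] D(1) by auto
    also have "\<dots> \<le> Max (B ` D)" using D(2) v by auto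
    finally show ?thesis .
  qed
  then show thesis by (rule that)
qed

text \<open>Used to trap images: a connected set that meets the image of a bounded open set without
  being contained in it must meet the image of the boundary.\<close>

lemma frontier_continuous_image:
  fixes f :: "complex \<Rightarrow> complex"
  assumes "continuous_on UNIV f" "bounded G" "open (f ` G)"
  shows "frontier (f ` G) \<subseteq> f ` frontier G"
proof -
  have "compact (f ` closure G)"
    using assms by (intro compact_continuous_image) (auto intro: continuous_on_subset)
  then have "closure (f ` G) \<subseteq> f ` closure G"
    by (intro closure_minimal image_mono closure_subset compact_imp_closed)
  then have "frontier (f ` G) \<subseteq> f ` closure G - f ` G"
    using assms(3) by (auto simp: frontier_def interior_open)
  also have "\<dots> \<subseteq> f ` (closure G - G)" by auto
  also have "\<dots> \<subseteq> f ` frontier G"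
    unfolding frontier_def using interior_subset by (intro image_mono) auto
  finally show ?thesis .
qed

text \<open>The union of the images of a disc is then bounded and \<open>f\<close> maps the complement of the outside of
  its closure \<open>E\<close> to itself. Let \<open>s\<close> be the distance from 0 to the outside of \<open>E\<close>. On the disc of
  radius \<open>s\<close> the function omits two values of size comparable to \<open>s\<close>, so Schottky's theorem bounds it
  linearly in \<open>s\<close>.\<close>

lemma transcendental_iterates_not_locally_bounded:
  assumes te: "transcendental_entire f"
    and bdd: "\<And>r. \<exists>B. \<forall>n. \<forall>x\<in>cball 0 r. norm ((f ^^ n) x) \<le> B"
  shows False
proof -
  note hol = transcendental_entireD(1)[OF te]
  have cf: "continuous_on S f" for S
    using hol holomorphic_on_imp_continuous_on continuous_on_subset by blast
  \<comment> \<open>Schottky's bound on the disc of radius 1/2 for functions on the unit disc that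
    omit 0 and 1 and have modulus at most 2 at the centre.\<close>
  define C where "C = exp (pi * exp (pi * (2 + 2 * 2 + 12 * (1/2) / (1 - 1/2))))"
  have C: "C > 0" by (simp add: C_def)
  have growth: "\<exists>s\<ge>r. \<forall>z. norm z \<le> s / 4 \<longrightarrow> norm (f z) \<le> (6 * C + 2) * s"
    if r: "1 \<le> r" "norm (f 0) \<le> r" for r
  proof -
    define E where "E = closure (\<Union>n. (f ^^ n) ` cball 0 r)"
    obtain B where "\<And>n x. x \<in> cball 0 r \<Longrightarrow> norm ((f ^^ n) x) \<le> B" using bdd by blast
    then have bE: "bounded E"
      unfolding E_def by (intro bounded_closure boundedI[of _ B]) auto
    have fE: "f ` E \<subseteq> E"
    proof -
      have "f ` E \<subseteq> closure (f ` (\<Union>n. (f ^^ n) ` cball 0 r))"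
        unfolding E_def by (intro image_closure_subset cf) (auto simp: closure_subset)
      also have "\<dots> \<subseteq> E"
        unfolding E_def
      proof (intro closure_mono subsetI)
        fix x assume "x \<in> f ` (\<Union>n. (f ^^ n) ` cball 0 r)"
        then obtain n y where y: "y \<in> cball 0 r" "x = f ((f ^^ n) y)" by auto
        then have "x = (f ^^ Suc n) y" by simp
        with y(1) show "x \<in> (\<Union>n. (f ^^ n) ` cball 0 r)" by blast
      qed
      finally show ?thesis .
    qed
    define W where "W = outside E"
    have W: "connected W" "\<not> bounded W"
      unfolding W_def using connected_outside[OF bE] unbounded_outside[OF bE] by simp_all
    have EW: "z \<notin> W" if "z \<in> E" for z
      using that outside_no_overlap[of E] unfolding W_def by blast
    \<comment> \<open>A point of \<open>inside E\<close> mapped into \<open>W\<close> would make the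
      connected unbounded \<open>W\<close> meet the frontier of the image of
      \<open>inside E\<close>. That frontier lies in the image of \<open>E\<close>, hence in
      \<open>E\<close>.\<close>
    have fW: "f z \<notin> W" if "z \<notin> W" for z
    proof
      assume "f z \<in> W"
      then have "f z \<notin> E" using EW by blast
      then have "z \<notin> E" using fE by auto
      then have z: "z \<in> inside E" using \<open>z \<notin> W\<close> inside_Un_outside[of E] unfolding W_def by blast
      have bi: "bounded (inside E)" by (rule bounded_inside[OF bE])
      have "open (f ` inside E)"
        using open_image_funpow[OF te open_inside[of E], of 1] by (simp add: E_def)
      then have "frontier (f ` inside E) \<subseteq> f ` frontier (inside E)"
        by (intro frontier_continuous_image cf bi)
      also have "\<dots> \<subseteq> f ` E" by (intro image_mono frontier_inside_subset) (simp add: E_def)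
      also have "\<dots> \<subseteq> E" by (rule fE)
      finally have "frontier (f ` inside E) \<inter> W = {}"
        using EW by blast
      moreover have "W \<inter> f ` inside E \<noteq> {}" using \<open>f z \<in> W\<close> z by auto
      moreover have "bounded (f ` inside E)"
        using compact_imp_bounded[OF compact_continuous_image[OF cf, of "closure (inside E)"]] bi
        by (meson bounded_subset closure_subset compact_closure image_mono)
      then have "W - f ` inside E \<noteq> {}" using W(2) bounded_subset by blast
      ultimately show False using connected_Int_frontier[OF W(1), of "f ` inside E"] by auto
    qed
    have cn: "connected (norm ` W)" by (intro connected_continuous_image continuous_intros W)
    define s where "s = Inf (norm ` W)"
    have bb: "bdd_below (norm ` W)" by (intro bdd_belowI[of _ 0]) auto
    have ne: "W \<noteq> {}" using W(2) by auto
    have "r \<le> s"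
      unfolding s_def
    proof (rule cInf_greatest)
      fix x assume "x \<in> norm ` W"
      then obtain z where z: "z \<in> W" "x = norm z" by auto
      have "z \<notin> cball 0 r"
      proof
        assume "z \<in> cball 0 r"
        then have "z \<in> (f ^^ 0) ` cball 0 r" by simp
        then have "z \<in> E" unfolding E_def using closure_subset by fast
        then show False using z EW by blast
      qed
      then show "r \<le> x" using z by auto
    qed (use ne in auto)
    have out: "z \<notin> W" if "norm z < s" for z
      using that cInf_lower[OF _ bb, of "norm z"] by (force simp: s_def)
    have hit: "\<exists>e\<in>W. norm e = t" if st: "s < t" for t
    proof -
      obtain a where a: "a \<in> norm ` W" "a < t" using st cInf_lessD[of "norm ` W" t] ne by (auto simp: s_def)
      obtain b where b: "b \<in> W" "t < norm b" using W(2) by (meson bounded_iff linorder_not_le)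
      have "t \<in> norm ` W" using connectedD_interval[OF cn a(1), of "norm b" t] a b by auto
      then show ?thesis by auto
    qed
    \<comment> \<open>The moduli of points of \<open>W\<close> fill the ray beyond \<open>s\<close>.
      With moduli \<open>2 * s\<close> and \<open>4 * s\<close> the two points are at distance
      between \<open>2 * s\<close> and \<open>6 * s\<close>, whatever their arguments.\<close>
    obtain e e' where e: "e \<in> W" "norm e = 2 * s" "e' \<in> W" "norm e' = 4 * s"
      using hit[of "2 * s"] hit[of "4 * s"] \<open>r \<le> s\<close> r(1) by force
    have s: "s > 0" using \<open>r \<le> s\<close> r(1) by simp
    have ee: "2 * s \<le> norm (e' - e)" "norm (e' - e) \<le> 6 * s"
      using norm_triangle_ineq2[of e' e] norm_triangle_ineq4[of e' e] e by auto
    \<comment> \<open>Normalised to omit 0 and 1. The closed unit disc corresponds to the disc of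
      radius \<open>s/2\<close>, well inside the disc of radius \<open>s\<close> that
      \<open>W\<close> avoids; half of it gives the bound up to \<open>s/4\<close>.\<close>
    define F where "F z = (f (of_real (s/2) * z) - e) / (e' - e)" for z
    have small: "norm (of_real (s/2) * z) < s" if "norm z \<le> 1" for z :: complex
    proof -
      have "norm (of_real (s/2) * z) = s/2 * norm z" using s by (simp add: norm_mult)
      also have "\<dots> \<le> s/2 * 1" using s that by (intro mult_left_mono) auto
      also have "\<dots> < s" using s by simp
      finally show ?thesis .
    qed
    have F: "norm (F z) \<le> C" if z: "norm z \<le> 1/2" for z
      unfolding C_def
    proof (rule Schottky[where f = F and z = z and t = "1/2" and r = 2])
      show "F holomorphic_on cball 0 1"
        unfolding F_def using e ee s
        by (intro holomorphic_intros holomorphic_on_compose_gen[OF _ hol, unfolded o_def]) auto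
      have "norm (F 0) = norm (f 0 - e) / norm (e' - e)" by (simp add: F_def norm_divide)
      also have "\<dots> \<le> (norm (f 0) + norm e) / (2 * s)"
        using s ee norm_triangle_ineq4[of "f 0" e] by (intro frac_le) auto
      also have "\<dots> \<le> (s + 2 * s) / (2 * s)"
        using s e r \<open>r \<le> s\<close> by (intro divide_right_mono) auto
      also have "\<dots> \<le> 2" using s by simp
      finally show "norm (F 0) \<le> 2" .
      fix z :: complex assume "z \<in> cball 0 1"
      then have "f (of_real (s/2) * z) \<notin> W" using small[of z] fW out by auto
      then show "\<not> (F z = 0 \<or> F z = 1)" using e ee s by (auto simp: F_def divide_eq_1_iff)
    qed (use z in auto)
    have "norm (f z) \<le> (6 * C + 2) * s" if "norm z \<le> s / 4" for z
    proof -
      define w where "w = z / of_real (s/2)"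
      have w: "norm w \<le> 1/2" "z = of_real (s/2) * w"
        using that s by (auto simp: w_def norm_divide field_simps)
      have "f z = e + F w * (e' - e)" using ee s unfolding F_def w(2)[symmetric] by auto
      then have "norm (f z) \<le> norm e + norm (F w) * norm (e' - e)"
        by (metis norm_mult norm_triangle_ineq)
      also have "\<dots> \<le> 2 * s + C * (6 * s)"
        using e ee s C F[OF w(1)] by (intro add_mono mult_mono) auto
      finally show ?thesis by (simp add: algebra_simps)
    qed
    then show ?thesis using \<open>r \<le> s\<close> by blast
  qed
  \<comment> \<open>Cauchy's inequality on the disc of radius \<open>s/4\<close>: with a bound
    linear in \<open>s\<close>, the derivative of order \<open>n\<close> is at most a constant times
    \<open>1 / s\<close> for arbitrarily large \<open>s\<close>.\<close>
  have zero: "(deriv ^^ n) f 0 = 0" if n: "2 \<le> n" for n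
  proof (rule ccontr)
    assume nz: "(deriv ^^ n) f 0 \<noteq> 0"
    define A where "A = fact n * (6 * C + 2) * 4 ^ n"
    define r where "r = max (max 1 (norm (f 0))) (A / norm ((deriv ^^ n) f 0) + 1)"
    have "1 \<le> r" "norm (f 0) \<le> r" by (auto simp: r_def)
    from growth[OF this] obtain s where s: "r \<le> s" "\<And>z. norm z \<le> s / 4 \<Longrightarrow> norm (f z) \<le> (6 * C + 2) * s"
      by blast
    have s1: "1 \<le> s" using s(1) by (auto simp: r_def)
    have "norm ((deriv ^^ n) f 0) \<le> fact n * ((6 * C + 2) * s) / (s / 4) ^ n"
      by (rule Cauchy_inequality) (use hol cf s s1 in \<open>auto intro: holomorphic_on_subset\<close>)
    also have "\<dots> = A * s / s ^ n" by (simp add: A_def power_divide)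
    also have "\<dots> \<le> A * s / s ^ 2"
      using s1 n C by (intro divide_left_mono power_increasing) (auto simp: A_def)
    also have "\<dots> = A / s" using s1 by (simp add: power2_eq_square)
    finally have "norm ((deriv ^^ n) f 0) * s \<le> A" using s1 by (simp add: field_simps)
    then have "s \<le> A / norm ((deriv ^^ n) f 0)" using nz by (simp add: field_simps)
    then show False using s(1) by (auto simp: r_def)
  qed
  have "f z = poly [:f 0, deriv f 0:] z" for z
  proof -
    have "(\<lambda>n. (deriv ^^ n) f 0 / fact n * (z - 0) ^ n) sums f z"
      by (rule holomorphic_power_series[of f 0 "norm z + 1"]) (use hol in \<open>auto intro: holomorphic_on_subset\<close>)
    moreover have "(\<lambda>n. (deriv ^^ n) f 0 / fact n * (z - 0) ^ n) sums
        (\<Sum>n<2. (deriv ^^ n) f 0 / fact n * (z - 0) ^ n)"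
      by (rule sums_finite) (use zero in auto)
    ultimately have "f z = (\<Sum>n<2. (deriv ^^ n) f 0 / fact n * (z - 0) ^ n)" by (rule sums_unique2)
    then show ?thesis by (simp add: numeral_2_eq_2 algebra_simps)
  qed
  then show False using te unfolding transcendental_entire_def by blast
qed

text \<open>A point fixed by the second iterate has a bounded orbit. If it differs from the only
  possible Julia point \<open>c\<close>, bounded orbits spread over the connected complement of
  \<open>c\<close>, the iterates are bounded on circles around \<open>c\<close>, and the maximum
  principle bounds them on discs, against the preceding lemma. The two cases only produce such a
  point, from the fact that an entire function other than a translation has a point fixed by its
  second iterate.\<close>

lemma julia_set_not_subset_singleton:
  assumes te: "transcendental_entire f"
  shows "\<not> julia_set f \<subseteq> {a}"
proof
  assume "julia_set f \<subseteq> {a}"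
  note hol = transcendental_entireD(1)[OF te]
  obtain c x where sub: "julia_set f \<subseteq> {c}" and x: "x \<noteq> c" "f (f x) = x"
  proof (cases "julia_set f = {}")
    case True
    have "f \<noteq> (\<lambda>x. a + x)" for a
    proof
      assume "f = (\<lambda>x. a + x)"
      then have "\<forall>z. f z = poly [:a, 1:] z" by simp
      then show False using te unfolding transcendental_entire_def by blast
    qed
    then obtain x where "f (f x) = x" using holomorphic_involution_point[OF hol] by metis
    then show thesis using True that[of "x + 1" x] by auto
  next
    case False
    with \<open>julia_set f \<subseteq> {a}\<close> have J: "julia_set f = {a}" by auto
    then have fa: "f z = a \<longleftrightarrow> z = a" for z
      using julia_set_iff[OF te, of 1 z] by auto
    have hol': "(\<lambda>u. f (a + exp u) - a) holomorphic_on UNIV"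
      by (intro holomorphic_intros holomorphic_on_compose_gen[OF _ hol, unfolded o_def]) auto
    txt \<open>A fixed point of \<open>F \<circ> F\<close> gives a point other than \<open>a\<close> that \<open>f \<circ> f\<close> fixes.\<close>
    obtain F where F: "F holomorphic_on UNIV" "\<And>u. exp (F u) = f (a + exp u) - a"
      by (rule holomorphic_logarithm_exists[OF convex_UNIV open_UNIV hol' _ UNIV_I]) (use fa in auto)
    have "F \<noteq> (\<lambda>x. b + x)" for b
    proof
      assume Fb: "F = (\<lambda>x. b + x)"
      have "f z = a + exp b * (z - a)" for z
      proof (cases "z = a")
        case True then show ?thesis using fa[of a] by simp
      next
        case False
        then show ?thesis using F(2)[of "Ln (z - a)"] by (simp add: Fb exp_add)
      qed
      then have "\<forall>z. f z = poly [:a - exp b * a, exp b:] z" by (simp add: algebra_simps)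
      then show False using te unfolding transcendental_entire_def by blast
    qed
    then obtain u where u: "F (F u) = u" using holomorphic_involution_point[OF F(1)] by metis
    have "f (a + exp v) = a + exp (F v)" for v using F(2)[of v] by (simp add: algebra_simps)
    then have "f (f (a + exp u)) = a + exp u" using u by simp
    then show thesis using J that[of a "a + exp u"] by auto
  qed
  have orb: "(f ^^ n) x = x \<or> (f ^^ n) x = f x" for n
    by (induction n) (use x(2) in auto)
  have "norm ((f ^^ n) x) \<le> max (norm x) (norm (f x))" for n
    using orb[of n] by auto
  moreover have "connected (- {c})" by (rule connected_punctured_universe) simp
  moreover have "- {c} \<subseteq> fatou_set f" using sub by (auto simp: julia_set_def)
  ultimately have bd: "\<exists>B. \<forall>n. \<forall>y\<in>K. norm ((f ^^ n) y) \<le> B" if "compact K" "K \<subseteq> - {c}" for K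
    using fatou_connected_bounded_orbits[OF hol, of "- {c}" x "max (norm x) (norm (f x))" K] x(1) that
    by (metis ComplI singletonD)
  have "\<exists>B. \<forall>n. \<forall>y\<in>cball 0 r. norm ((f ^^ n) y) \<le> B" for r
  proof -
    \<comment> \<open>The circle of radius \<open>R\<close> about \<open>c\<close> avoids
      \<open>c\<close>, and its disc contains \<open>cball 0 r\<close>.\<close>
    define R where "R = \<bar>r\<bar> + norm c + 1"
    have "R > 0" by (simp add: R_def add_nonneg_pos)
    then have "sphere c R \<subseteq> - {c}" by auto
    then obtain B where B: "\<And>n y. y \<in> sphere c R \<Longrightarrow> norm ((f ^^ n) y) \<le> B"
      using bd[OF compact_sphere] by blast
    have "norm ((f ^^ n) y) \<le> B" if "y \<in> cball 0 r" for n y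
    proof (rule maximum_modulus_frontier[of "f ^^ n" "cball c R"])
      show "norm ((f ^^ n) z) \<le> B" if "z \<in> frontier (cball c R)" for z
        using B that \<open>R > 0\<close> by (simp add: frontier_cball)
      show "y \<in> cball c R"
        using that norm_triangle_ineq4[of c y] by (auto simp: R_def dist_norm)
    qed (use hol in \<open>auto intro: holomorphic_on_subset[OF holomorphic_on_funpow] continuous_on_funpow_holomorphic\<close>)
    then show ?thesis by blast
  qed
  then show False by (rule transcendental_iterates_not_locally_bounded[OF te])
qed

text \<open>A finite completely invariant set contains only values with finitely many preimages, and
  Picard's theorem leaves at most one of those.\<close>

lemma infinite_julia_set:
  assumes te: "transcendental_entire f"
  shows "infinite (julia_set f)"
proof
  assume fin: "finite (julia_set f)"
  obtain a where a: "\<And>w. w \<noteq> a \<Longrightarrow> infinite (f -` {w})" using transcendental_infinite_preimage[OF te] by metis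
  have "w = a" if "w \<in> julia_set f" for w
  proof (rule ccontr)
    assume "w \<noteq> a"
    moreover have "f -` {w} \<subseteq> julia_set f" using julia_set_iff[OF te, of 1] that by auto
    ultimately show False using a fin finite_subset by blast
  qed
  then have "julia_set f \<subseteq> {a}" by auto
  then show False using julia_set_not_subset_singleton[OF te] by blast
qed

text \<open>A non-exceptional value in the Julia set has infinitely many preimages, all in the Julia
  set; a compact set can contain only finitely many of them.\<close>

lemma unbounded_julia_set:
  assumes te: "transcendental_entire f"
  shows "\<not> bounded (julia_set f)"
proof
  assume "bounded (julia_set f)"
  then have comp: "compact (julia_set f)" using closed_julia_set compact_eq_bounded_closed by blast
  obtain a where a: "\<And>w. w \<noteq> a \<Longrightarrow> infinite (f -` {w})" using transcendental_infinite_preimage[OF te] by metis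
  obtain w where w: "w \<in> julia_set f" "w \<noteq> a" using julia_set_not_subset_singleton[OF te, of a] by blast
  have "\<not> (\<lambda>z. f z - w) constant_on UNIV"
    using transcendental_entireD(2)[OF te] unfolding constant_on_def by (metis diff_add_cancel)
  then have "finite {z \<in> julia_set f. f z - w = 0}"
    using transcendental_entireD(1)[OF te]
    by (intro holomorphic_compact_finite_zeros[of _ UNIV] holomorphic_intros comp) auto
  moreover have "f -` {w} \<subseteq> {z \<in> julia_set f. f z - w = 0}"
    using julia_set_iff[OF te, of 1] w by auto
  ultimately show False using a[OF w(2)] finite_subset by blast
qed

subsection \<open>Locally connected sets\<close>

lemma locally_connected_compact_nhd:
  fixes S :: "'a::heine_borel set"
  assumes "closed S" "locally connected S" "x \<in> S" "0 < e"
  obtains V d where "compact V" "connected V" "V \<subseteq> S" "V \<subseteq> ball x e" "x \<in> V" "0 < d" "S \<inter> ball x d \<subseteq> V"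
proof -
  \<comment> \<open>The half radius leaves room for the closure of the connected
    neighbourhood.\<close>
  have "openin (top_of_set S) (S \<inter> ball x (e/2))" "x \<in> S \<inter> ball x (e/2)"
    using assms by (auto simp: openin_open_Int)
  then obtain U W where UW: "openin (top_of_set S) U" "connected W" "x \<in> U" "U \<subseteq> W" "W \<subseteq> S \<inter> ball x (e/2)"
    by (rule locallyE[OF assms(2)])
  obtain d where "0 < d" "ball x d \<inter> S \<subseteq> U"
    using UW(1,3) by (auto simp: openin_contains_ball)
  moreover have "closure W \<subseteq> S \<inter> cball x (e/2)"
    using UW(5) assms(1) by (intro closure_minimal) (auto simp: closed_Int)
  moreover have "cball x (e/2) \<subseteq> ball x e" using assms(4) by auto
  ultimately show thesis
    using UW closure_subset[of W]
    by (intro that[of "closure W" d]) (auto simp: connected_imp_connected_closure compact_closure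
      intro: bounded_subset[OF bounded_ball])
qed

text \<open>The union is the Minkowski sum of \<open>V\<close> and a ball, a continuous image of a
  connected product.\<close>

lemma connected_nhd:
  fixes V :: "'a::real_normed_vector set"
  assumes "connected V"
  shows "connected (\<Union>v\<in>V. ball v e)"
proof -
  have "(\<Union>v\<in>V. ball v e) = (\<lambda>(v, w). v + w) ` (V \<times> ball 0 e)"
  proof (intro subset_antisym subsetI)
    fix z assume "z \<in> (\<Union>v\<in>V. ball v e)"
    then obtain v where "v \<in> V" "dist v z < e" by auto
    then show "z \<in> (\<lambda>(v, w). v + w) ` (V \<times> ball 0 e)"
      by (intro image_eqI[of _ _ "(v, z - v)"]) (auto simp: dist_norm norm_minus_commute)
  next
    fix z assume "z \<in> (\<lambda>(v, w). v + w) ` (V \<times> ball 0 e)"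
    then show "z \<in> (\<Union>v\<in>V. ball v e)" by (auto intro!: bexI simp: dist_norm)
  qed
  also have "connected \<dots>"
    by (intro connected_continuous_image connected_Times assms)
       (auto intro!: continuous_intros simp: case_prod_unfold)
  finally show ?thesis .
qed

text \<open>Chains exist by connectedness. In a chain of least length non-consecutive links are
  disjoint, since a common point would be a shortcut.\<close>

lemma connected_simple_chain:
  fixes S :: "'a::metric_space set"
  assumes "connected S" "x \<in> S" "y \<in> S"
    and nhd: "\<And>z. z \<in> S \<Longrightarrow> \<exists>V. P V \<and> (\<exists>T. openin (top_of_set S) T \<and> z \<in> T \<and> T \<subseteq> V)"
  obtains V :: "nat \<Rightarrow> 'a set" and L where "\<And>i. i \<le> L \<Longrightarrow> P (V i)" "x \<in> V 0" "y \<in> V L"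
    "\<And>i. i < L \<Longrightarrow> V i \<inter> V (Suc i) \<noteq> {}" "\<And>i j. Suc i < j \<Longrightarrow> j \<le> L \<Longrightarrow> V i \<inter> V j = {}"
proof -
  define chain where "chain y L V \<longleftrightarrow> (\<forall>i\<le>L. P (V i)) \<and> x \<in> V 0 \<and> y \<in> V L \<and>
      (\<forall>i<L. V i \<inter> V (Suc i) \<noteq> {})" for y L and V :: "nat \<Rightarrow> 'a set"
  have "\<exists>L V. chain y L V"
  proof (rule connected_induction_simple[OF assms(1), where P = "\<lambda>y. \<exists>L V. chain y L V" and a = x])
    show "\<exists>L V. chain x L V"
    proof -
      obtain V where "P V" "x \<in> V" using nhd[OF assms(2)] by blast
      then have "chain x 0 (\<lambda>_. V)" by (simp add: chain_def)
      then show ?thesis by blast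
    qed
  next
    fix a assume "a \<in> S"
    then obtain W T where W: "P W" "openin (top_of_set S) T" "a \<in> T" "T \<subseteq> W"
      using nhd by blast
    have "\<exists>L V. chain v L V" if uv: "u \<in> T" "v \<in> T" and ch: "chain u L V" for u v L V
    proof -
      have "chain v (Suc L) (V(Suc L := W))"
        unfolding chain_def
      proof (intro conjI allI impI)
        fix i assume "i < Suc L"
        then consider "i < L" | "i = L" by linarith
        then show "(V(Suc L := W)) i \<inter> (V(Suc L := W)) (Suc i) \<noteq> {}"
        proof cases
          case 1 then show ?thesis using ch by (simp add: chain_def)
        next
          case 2
          have "u \<in> V L \<inter> W" using ch W(4) uv by (auto simp: chain_def)
          then show ?thesis using 2 by auto
        qed
      next
        fix i assume "i \<le> Suc L"
        then show "P ((V(Suc L := W)) i)"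
          using ch W(1) by (cases "i = Suc L") (simp_all add: chain_def)
      next
        show "x \<in> (V(Suc L := W)) 0" using ch unfolding chain_def by simp
        show "v \<in> (V(Suc L := W)) (Suc L)" using W(4) uv(2) by auto
      qed
      then show ?thesis by blast
    qed
    then show "\<exists>T. openin (top_of_set S) T \<and> a \<in> T \<and>
         (\<forall>x\<in>T. \<forall>y\<in>T. (\<exists>L V. chain x L V) \<longrightarrow> (\<exists>L V. chain y L V))"
      using W(2,3) by (intro exI[of _ T]) fast
  qed (use assms(2,3) in simp_all)
  then have ex: "\<exists>L V. chain y L V" .
  define L where "L = (LEAST L. \<exists>V. chain y L V)"
  have least: "L \<le> M" if "chain y M V" for M V
    unfolding L_def by (rule Least_le) (use that in blast)
  obtain V where V: "chain y L V"
    using LeastI_ex[OF ex] unfolding L_def by blast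
  have "V i \<inter> V j = {}" if ij: "Suc i < j" "j \<le> L" for i j
  proof (rule ccontr)
    assume ne: "V i \<inter> V j \<noteq> {}"
    \<comment> \<open>The links strictly between \<open>i\<close> and \<open>j\<close> are dropped,
      so that position \<open>Suc i\<close> holds \<open>V j\<close>.\<close>
    define V' where "V' k = (if k \<le> i then V k else V (k + (j - Suc i)))" for k
    have "chain y (L - (j - Suc i)) V'"
      unfolding chain_def
    proof (intro conjI allI impI)
      fix k assume "k < L - (j - Suc i)"
      then consider "k < i" | "k = i" | "k > i" "k + (j - Suc i) < L" by linarith
      then show "V' k \<inter> V' (Suc k) \<noteq> {}"
      proof cases
        case 1 then show ?thesis using V ij by (simp add: V'_def chain_def)
      next
        case 2 then show ?thesis using ne ij by (simp add: V'_def)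
      next
        case 3 then show ?thesis using V by (simp add: V'_def chain_def)
      qed
    qed (use V ij in \<open>auto simp: V'_def chain_def\<close>)
    then show False using least[of _ V'] ij by fastforce
  qed
  with V show thesis by (intro that[of L V]) (auto simp: chain_def)
qed

text \<open>The monotone \<open>k\<close> records the link that the arc is in. An arc in the next
  link is used only after its last meeting with the arc built so far, which is cut there; this
  removes self-intersections and keeps the order of the links.\<close>

lemma arc_through_chain:
  fixes X :: "nat \<Rightarrow> complex set"
  assumes "\<And>i. i \<le> L \<Longrightarrow> path_connected (X i)" "\<And>i. i < L \<Longrightarrow> X i \<inter> X (Suc i) \<noteq> {}"
    and "x \<in> X 0" "y \<in> X L" "x \<noteq> y"
  shows "\<exists>c k. arc c \<and> pathstart c = x \<and> pathfinish c = y \<and> mono_on {0..1} k \<and>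
    (\<forall>t\<in>{0..1}. k t \<le> L \<and> c t \<in> X (k t))"
  using assms
proof (induction L arbitrary: y)
  case 0
  then obtain g where "arc g" "path_image g \<subseteq> X 0" "pathstart g = x" "pathfinish g = y"
    using path_connected_arcwise[of "X 0"] by blast
  then show ?case
    by (intro exI[of _ g] exI[of _ "\<lambda>_. 0"]) (auto simp: path_image_def mono_on_def)
next
  case (Suc L)
  show ?case
  \<comment> \<open>If \<open>x\<close> is in the last link, the cut might fall on the start of
    \<open>c\<close> and leave no arc; but then the last link alone joins \<open>x\<close> to
    \<open>y\<close>.\<close>
  proof (cases "x \<in> X (Suc L)")
    case True
    then obtain g where "arc g" "path_image g \<subseteq> X (Suc L)" "pathstart g = x" "pathfinish g = y"
      using path_connected_arcwise[of "X (Suc L)"] Suc.prems by blast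
    then show ?thesis
      by (intro exI[of _ g] exI[of _ "\<lambda>_. Suc L"]) (auto simp: path_image_def mono_on_def)
  next
    case False
    obtain y' where y': "y' \<in> X L" "y' \<in> X (Suc L)" using Suc.prems(2)[of L] by auto
    with False have "x \<noteq> y'" by auto
    then obtain c k where c: "arc c" "pathstart c = x" "pathfinish c = y'" "mono_on {0..1} k"
        "\<And>t. t \<in> {0..1} \<Longrightarrow> k t \<le> L \<and> c t \<in> X (k t)"
      using Suc.IH[of y'] Suc.prems y' by auto
    obtain d where d: "path d" "path_image d \<subseteq> X (Suc L)" "pathstart d = y'" "pathfinish d = y"
        "y \<noteq> y' \<Longrightarrow> arc d"
    proof (cases "y = y'")
      case True
      then show thesis using y' by (intro that[of "linepath y y"]) auto
    next
      case False
      then show thesis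
        using that path_connected_arcwise[of "X (Suc L)"] Suc.prems(1)[of "Suc L"] Suc.prems(4) y'
        by (metis arc_imp_path le_refl)
    qed
    define T where "T = {0..1} \<inter> d -` path_image c"
    have "closed T"
      unfolding T_def using d(1) c(1)
      by (intro continuous_closed_preimage closed_path_image arc_imp_path) (auto simp: path_def)
    moreover have "0 \<in> T"
      using d(3) c(3) pathfinish_in_path_image[of c] by (simp add: T_def pathstart_def)
    moreover have "bounded T" by (rule bounded_subset[of "{0..1}"]) (auto simp: T_def)
    ultimately have "compact T" "T \<noteq> {}" by (auto simp: compact_eq_bounded_closed)
    then obtain u where u: "u \<in> T" and max: "\<And>t. t \<in> T \<Longrightarrow> t \<le> u"
      using compact_attains_sup by metis
    obtain v where v: "v \<in> {0..1}" "c v = d u"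
      using u by (auto simp: T_def path_image_def)
    have "v \<noteq> 0"
    proof
      assume "v = 0"
      then have "d u = x" using v c(2) by (simp add: pathstart_def)
      moreover have "d u \<in> X (Suc L)"
        using u d(2) unfolding T_def path_image_def by blast
      ultimately show False using False by simp
    qed
    define c' where "c' = subpath 0 v c"
    have c': "arc c'" "path_image c' \<subseteq> path_image c" "pathstart c' = x" "pathfinish c' = d u"
      unfolding c'_def using v c \<open>v \<noteq> 0\<close>
      by (auto intro: arc_subpath_arc simp: path_image_subpath_subset pathstart_def[of c] pathstart_subpath pathfinish_subpath)
    have c'X: "k (v * t) \<le> L \<and> c' t \<in> X (k (v * t))" if "t \<in> {0..1}" for t
      using c(5)[of "v * t"] v that by (auto simp: c'_def subpath_def mult_le_one)
    show ?thesis
    \<comment> \<open>For \<open>u = 1\<close> the point \<open>y\<close> already lies on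
      \<open>c\<close>, and the truncated arc suffices. This includes the constant path
      \<open>d\<close>.\<close>
    proof (cases "u = 1")
      case True
      with d(4) c'(4) have "pathfinish c' = y" by (simp add: pathfinish_def)
      moreover have "mono_on {0..1} (\<lambda>t. k (v * t))"
        using v by (intro mono_onI mono_onD[OF c(4)]) (auto simp: mult_le_one intro!: mult_left_mono)
      ultimately show ?thesis
        using c' c'X by (intro exI[of _ c'] exI[of _ "\<lambda>t. k (v * t)"]) fastforce
    next
      case False
      define d' where "d' = subpath u 1 d"
      have u01: "u \<in> {0..1}" using u by (auto simp: T_def)
      have "y \<noteq> y'"
        using max[of 1] False u01 c(3) d(4) unfolding T_def pathfinish_def
        by (auto simp: path_image_def)
      then have d': "arc d'" "pathstart d' = d u" "pathfinish d' = y"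
        unfolding d'_def using d u01 False
        by (auto intro: arc_subpath_arc simp: pathfinish_def[of d] pathstart_subpath pathfinish_subpath)
      have d'X: "d' t \<in> X (Suc L)" if "t \<in> {0..1}" for t
      proof -
        have "(1 - u) * t \<le> (1 - u) * 1" using that u01 by (intro mult_left_mono) auto
        then show ?thesis
          using that u01 d(2) by (auto simp: d'_def subpath_def path_image_def image_subset_iff)
      qed
      have "path_image d' \<inter> path_image c' \<subseteq> {d u}"
      proof
        fix z assume z: "z \<in> path_image d' \<inter> path_image c'"
        then have "z \<in> d ` {u..1}"
          using u01 unfolding d'_def by (simp add: path_image_subpath)
        then obtain t where t: "t \<in> {u..1}" "z = d t" by auto
        then have "t \<in> T" using z c'(2) u01 by (auto simp: T_def)
        then show "z \<in> {d u}" using max[of t] t by auto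
      qed
      then have arc: "arc (c' +++ d')"
        using c' d' by (intro arc_join) auto
      define k' where "k' t = (if t \<le> 1/2 then k (v * (2 * t)) else Suc L)" for t
      have kL: "k (v * (2 * t)) \<le> L" if "0 \<le> t" "t \<le> 1/2" for t
        using c'X[of "2 * t"] that by auto
      have "mono_on {0..1} k'"
        unfolding mono_on_def
      proof (intro allI impI)
        fix s t :: real assume st: "s \<in> {0..1} \<and> t \<in> {0..1} \<and> s \<le> t"
        show "k' s \<le> k' t"
        proof (cases "t \<le> 1/2")
          case True
          then have "k (v * (2 * s)) \<le> k (v * (2 * t))"
            using st v mult_le_one[of v "2 * t"] mult_le_one[of v "2 * s"]
            by (intro mono_onD[OF c(4)]) (auto intro!: mult_left_mono mult_right_mono)
          then show ?thesis using True st by (simp add: k'_def)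
        next
          case False
          then show ?thesis using kL[of s] st by (auto simp: k'_def intro: le_SucI)
        qed
      qed
      moreover have "k' t \<le> Suc L \<and> (c' +++ d') t \<in> X (k' t)" if "t \<in> {0..1}" for t
        using that c'X[of "2 * t"] d'X[of "2 * t - 1"] by (auto simp: k'_def joinpaths_def)
      ultimately show ?thesis
        using arc c' d' by (intro exI[of _ "c' +++ d'"] exI[of _ k']) auto
    qed
  qed
qed

text \<open>The constant \<open>m\<close> does not depend on \<open>e\<close> and \<open>C\<close>. This replaces an arc inside \<open>S\<close>: arcs near \<open>S\<close>
  can avoid a countable set, and they never return to a place they have left.\<close>

lemma nonbacktracking_arcs:
  fixes S :: "complex set"
  assumes "closed S" "connected S" "locally connected S" "x \<in> S" "y \<in> S" "x \<noteq> y" "0 < d"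
  obtains m where "0 < m"
    "\<And>e C. 0 < e \<Longrightarrow> countable C \<Longrightarrow> x \<notin> C \<Longrightarrow> y \<notin> C \<Longrightarrow>
      \<exists>c. arc c \<and> pathstart c = x \<and> pathfinish c = y \<and> path_image c \<inter> C = {} \<and>
        (\<forall>z\<in>path_image c. \<exists>w\<in>S. dist w z < e) \<and>
        (\<forall>s u t. 0 \<le> s \<longrightarrow> s \<le> u \<longrightarrow> u \<le> t \<longrightarrow> t \<le> 1 \<longrightarrow> dist (c s) (c t) < m \<longrightarrow>
            dist (c u) (c s) < d \<and> dist (c u) (c t) < d)"
proof -
  \<comment> \<open>With \<open>d/16\<close>, two meeting links, each fattened by at most
    \<open>d/16\<close>, have a union of diameter below \<open>d\<close>.\<close>
  define P where "P V \<longleftrightarrow> compact V \<and> connected V \<and> V \<subseteq> S \<and> (\<exists>z. V \<subseteq> ball z (d/16))" for V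
  have nhd: "\<exists>V. P V \<and> (\<exists>T. openin (top_of_set S) T \<and> z \<in> T \<and> T \<subseteq> V)" if zS: "z \<in> S" for z
  proof -
    obtain V r where "compact V" "connected V" "V \<subseteq> S" "V \<subseteq> ball z (d/16)" "0 < r" "S \<inter> ball z r \<subseteq> V"
      by (rule locally_connected_compact_nhd[OF assms(1,3) zS, of "d/16"]) (use assms in auto)
    then show ?thesis using zS unfolding P_def
      by (intro exI[of _ V] conjI exI[of _ "S \<inter> ball z r"]) (auto simp: openin_open_Int)
  qed
  obtain V :: "nat \<Rightarrow> complex set" and L where V: "\<And>i. i \<le> L \<Longrightarrow> P (V i)" "x \<in> V 0" "y \<in> V L"
    "\<And>i. i < L \<Longrightarrow> V i \<inter> V (Suc i) \<noteq> {}" "\<And>i j. Suc i < j \<Longrightarrow> j \<le> L \<Longrightarrow> V i \<inter> V j = {}"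
    by (rule connected_simple_chain[OF assms(2,4,5) nhd]) blast+
  have "\<exists>D>0. Suc i < j \<longrightarrow> j \<le> L \<longrightarrow> (\<forall>a\<in>V i. \<forall>b\<in>V j. D \<le> dist a b)" for i j
  proof (cases "Suc i < j \<and> j \<le> L")
    case True
    then have "compact (V i)" "closed (V j)" "V i \<inter> V j = {}"
      using V(1)[of i] V(1)[of j] V(5)[of i j] by (auto simp: P_def compact_imp_closed)
    then show ?thesis using separate_compact_closed by metis
  qed (auto intro: exI[of _ 1])
  then obtain D where D: "\<And>i j. 0 < D i j"
    "\<And>i j a b. Suc i < j \<Longrightarrow> j \<le> L \<Longrightarrow> a \<in> V i \<Longrightarrow> b \<in> V j \<Longrightarrow> (D i j :: real) \<le> dist a b"
    by metis
  \<comment> \<open>Three times \<open>m\<close> bounds from below the gap between any two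
    non-consecutive links, so fattening both by \<open>r \<le> m\<close> leaves at least
    \<open>m\<close>. Only the chain enters here, which makes \<open>m\<close> independent of
    \<open>e\<close> and \<open>C\<close>.\<close>
  define m where "m = Min (case_prod D ` ({..L} \<times> {..L})) / 3"
  have m: "0 < m" "\<And>i j. i \<le> L \<Longrightarrow> j \<le> L \<Longrightarrow> 3 * m \<le> D i j"
    unfolding m_def using D(1) by (auto simp: Min_gr_iff intro!: Min_le)
  show thesis
  proof (rule that[OF m(1)])
    fix e :: real and C :: "complex set"
    assume e: "0 < e" and C: "countable C" "x \<notin> C" "y \<notin> C"
    define r where "r = min e (min m (d/16))"
    have r: "0 < r" "r \<le> e" "r \<le> m" "r \<le> d/16" using e m assms by (auto simp: r_def)
    \<comment> \<open>A connected open plane set stays path connected when a countable set is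
      removed, so the arc can be led around \<open>C\<close>.\<close>
    define X where "X i = (\<Union>v\<in>V i. ball v r) - C" for i
    have "path_connected (X i)" if "i \<le> L" for i
      unfolding X_def using V(1)[OF that] C
      by (intro path_connected_open_diff_countable connected_nhd) (auto simp: P_def)
    moreover have "X i \<inter> X (Suc i) \<noteq> {}" if iL: "i < L" for i
    proof -
      obtain p where p: "p \<in> V i" "p \<in> V (Suc i)" using V(4)[OF iL] by auto
      have "\<not> ball p r \<subseteq> C"
        using C(1) r(1) uncountable_ball countable_subset by blast
      then show ?thesis using p by (auto simp: X_def)
    qed
    moreover have "x \<in> X 0" "y \<in> X L"
      using V(2,3) C r(1) by (auto simp: X_def intro: bexI[of _ x] bexI[of _ y])
    ultimately obtain c k where c: "arc c" "pathstart c = x" "pathfinish c = y" "mono_on {0..1} k"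
      "\<And>t. t \<in> {0..1} \<Longrightarrow> k t \<le> L \<and> c t \<in> X (k t)"
      using arc_through_chain[of L X x y] assms by metis
    have near: "dist a b < d" if ij: "i \<le> L" "j \<le> L" "i = j \<or> Suc i = j \<or> i = Suc j" and ab: "a \<in> X i" "b \<in> X j" for i j a b
    proof -
      obtain p where p: "p \<in> V i" "p \<in> V j"
      proof (cases "i = j")
        case True
        then show thesis using ab that by (auto simp: X_def)
      next
        case False
        then show thesis using ij V(4)[of i] V(4)[of j] that by auto
      qed
      have *: "dist q p < d/2" if i: "i \<le> L" "p \<in> V i" "q \<in> X i" for i q
      proof -
        obtain z where z: "V i \<subseteq> ball z (d/16)" using V(1)[OF i(1)] by (auto simp: P_def)
        obtain v where v: "v \<in> V i" "dist v q < r" using i(3) by (auto simp: X_def)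
        have "dist q p \<le> dist q v + dist v z + dist z p"
          by (meson dist_triangle_le dist_triangle add_right_mono order_trans)
        also have "\<dots> < r + d/16 + d/16"
          using v z i by (intro add_strict_mono) (auto simp: dist_commute)
        also have "\<dots> \<le> d/2" using r assms by simp
        finally show ?thesis .
      qed
      show ?thesis using *[of i a] *[of j b] p ij ab dist_triangle2[of a b p] by auto
    qed
    have "dist (c u) (c s) < d \<and> dist (c u) (c t) < d"
      if st: "0 \<le> s" "s \<le> u" "u \<le> t" "t \<le> 1" and lt: "dist (c s) (c t) < m" for s u t
    proof -
      have mem: "s \<in> {0..1}" "u \<in> {0..1}" "t \<in> {0..1}" using st by auto
      have k: "k s \<le> k u" "k u \<le> k t" using st mem by (auto intro: mono_onD[OF c(4)])
      \<comment> \<open>Nearness of the two ends puts them in equal or adjacent links, and by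
        monotonicity everything in between is in these links too.\<close>
      have "k t \<le> Suc (k s)"
      proof (rule ccontr)
        assume "\<not> k t \<le> Suc (k s)"
        moreover obtain v w where v: "v \<in> V (k s)" "dist v (c s) < r" "w \<in> V (k t)" "dist w (c t) < r"
          using c(5)[OF mem(1)] c(5)[OF mem(3)] by (auto simp: X_def)
        ultimately have "3 * m \<le> dist v w"
          using m(2)[of "k s" "k t"] D(2)[of "k s" "k t" v w] c(5)[OF mem(1)] c(5)[OF mem(3)] by force
        also have "dist v w \<le> dist v (c s) + dist (c s) (c t) + dist (c t) w"
          by (meson dist_triangle_le dist_triangle add_right_mono order_trans)
        also have "\<dots> < r + m + r" using v lt by (intro add_strict_mono) (auto simp: dist_commute)
        finally show False using r by simp
      qed
      with k show ?thesis
        using c(5)[OF mem(1)] c(5)[OF mem(2)] c(5)[OF mem(3)]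
        by (intro conjI near[of "k u" "k s"] near[of "k u" "k t"]) auto
    qed
    moreover have "\<exists>w\<in>S. dist w z < e" if z: "z \<in> path_image c" for z
    proof -
      obtain t where t: "t \<in> {0..1}" "z = c t" using z by (auto simp: path_image_def)
      with c(5)[OF t(1)] obtain v where "v \<in> V (k t)" "dist v z < r" by (auto simp: X_def)
      moreover have "V (k t) \<subseteq> S" using c(5)[OF t(1)] V(1) by (auto simp: P_def)
      ultimately show ?thesis using r by (intro bexI[of _ v]) auto
    qed
    moreover have "path_image c \<inter> C = {}" using c(5) by (auto simp: path_image_def X_def)
    ultimately show "\<exists>c. arc c \<and> pathstart c = x \<and> pathfinish c = y \<and> path_image c \<inter> C = {} \<and>
        (\<forall>z\<in>path_image c. \<exists>w\<in>S. dist w z < e) \<and>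
        (\<forall>s u t. 0 \<le> s \<longrightarrow> s \<le> u \<longrightarrow> u \<le> t \<longrightarrow> t \<le> 1 \<longrightarrow> dist (c s) (c t) < m \<longrightarrow>
            dist (c u) (c s) < d \<and> dist (c u) (c t) < d)"
      using c by (intro exI[of _ c]) blast
  qed
qed

subsection \<open>Topology of a locally connected Julia set\<close>

text \<open>An iterate of the disc contains two of any three Julia points. By complete invariance
  they come from Julia points of the disc, so both would be the image of \<open>y\<close> if
  \<open>y\<close> were the only one.\<close>

lemma julia_set_not_isolated:
  assumes te: "transcendental_entire f" and y: "y \<in> julia_set f" and "0 < e"
  shows "\<exists>x\<in>julia_set f. x \<noteq> y \<and> dist y x < e"
proof (rule ccontr)
  assume no: "\<not> ?thesis"
  obtain S where S: "S \<subseteq> julia_set f" "finite S" "card S = 3"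
    using infinite_arbitrarily_large[OF infinite_julia_set[OF te]] by metis
  obtain n where n: "\<And>a b. a \<in> S \<Longrightarrow> b \<in> S \<Longrightarrow> a \<noteq> b \<Longrightarrow> a \<in> (f ^^ n) ` ball y e \<or> b \<in> (f ^^ n) ` ball y e"
    by (rule julia_set_blow_up[OF te y open_ball connected_ball _ S(2), of y e]) (use assms in auto)
  have eq: "v = (f ^^ n) y" if v: "v \<in> S" "v \<in> (f ^^ n) ` ball y e" for v
  proof -
    obtain u where u: "v = (f ^^ n) u" "u \<in> ball y e" using v(2) by blast
    then have "u \<in> julia_set f" using v S(1) julia_set_iff[OF te, of n u] by blast
    then show ?thesis using u no by auto
  qed
  obtain a b c where abc: "S = {a, b, c}" "a \<noteq> b" "b \<noteq> c" "a \<noteq> c"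
    using S(3) by (auto simp: card_3_iff)
  then show False
    using n[of a b] n[of b c] n[of a c] eq[of a] eq[of b] eq[of c] by auto
qed

lemma connected_julia_set:
  assumes te: "transcendental_entire f" and lc: "locally connected (julia_set f)"
  shows "connected (julia_set f)"
proof (rule ccontr)
  let ?J = "julia_set f"
  assume "\<not> connected ?J"
  then obtain A B where AB: "openin (top_of_set ?J) A" "openin (top_of_set ?J) B" "?J \<subseteq> A \<union> B"
      "A \<inter> B = {}" "A \<noteq> {}" "B \<noteq> {}"
    unfolding connected_openin by blast
  have J: "?J = A \<union> B" using AB openin_imp_subset by blast
  \<comment> \<open>Each part must supply two points, because the iterate of a neighbourhood may
    miss one of the four.\<close>
  have two: "\<exists>x y. x \<in> A \<and> y \<in> A \<and> x \<noteq> y" if A: "openin (top_of_set ?J) A" "A \<noteq> {}" for A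
  proof -
    obtain x where x: "x \<in> A" using A by auto
    then obtain e where "0 < e" "ball x e \<inter> ?J \<subseteq> A" using A(1) by (auto simp: openin_contains_ball)
    moreover have "x \<in> ?J" using x A(1) openin_imp_subset by blast
    ultimately obtain w where "w \<in> A" "w \<noteq> x" using julia_set_not_isolated[OF te, of x e] by auto
    then show ?thesis using x by blast
  qed
  obtain a a' where a: "a \<in> A" "a' \<in> A" "a \<noteq> a'" using two AB by blast
  obtain b b' where b: "b \<in> B" "b' \<in> B" "b \<noteq> b'" using two AB by blast
  have aJ: "a \<in> ?J" using a J by auto
  obtain V d where V: "compact V" "connected V" "V \<subseteq> ?J" "0 < d" "?J \<inter> ball a d \<subseteq> V"
    by (rule locally_connected_compact_nhd[OF closed_julia_set lc aJ zero_less_one])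
  obtain n where n: "\<And>x y. x \<in> {a, a', b, b'} \<Longrightarrow> y \<in> {a, a', b, b'} \<Longrightarrow> x \<noteq> y \<Longrightarrow>
      x \<in> (f ^^ n) ` ball a d \<or> y \<in> (f ^^ n) ` ball a d"
    by (rule julia_set_blow_up[OF te aJ open_ball connected_ball, of a d "{a, a', b, b'}"]) (use V in auto)
  have inV: "x \<in> (f ^^ n) ` V" if x: "x \<in> ?J" "x \<in> (f ^^ n) ` ball a d" for x
  proof -
    obtain u where u: "x = (f ^^ n) u" "u \<in> ball a d" using x(2) by blast
    then have "u \<in> ?J" using x julia_set_iff[OF te, of n u] by blast
    then show ?thesis using u V by blast
  qed
  have "connected ((f ^^ n) ` V)"
    by (intro connected_continuous_image continuous_on_funpow_holomorphic V transcendental_entireD(1)[OF te])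
  moreover have sub: "(f ^^ n) ` V \<subseteq> ?J" using V(3) julia_set_iff[OF te] by auto
  moreover have "A \<inter> (f ^^ n) ` V \<noteq> {}" using n[of a a'] inV[of a] inV[of a'] a J by blast
  moreover have "B \<inter> (f ^^ n) ` V \<noteq> {}" using n[of b b'] inV[of b] inV[of b'] b J by blast
  moreover have "openin (top_of_set ((f ^^ n) ` V)) (A \<inter> (f ^^ n) ` V)" "openin (top_of_set ((f ^^ n) ` V)) (B \<inter> (f ^^ n) ` V)"
  proof -
    have "openin (top_of_set W) (X \<inter> W)" if X: "openin (top_of_set ?J) X" and W: "W \<subseteq> ?J" for X W
    proof -
      obtain T where "open T" "X = ?J \<inter> T" using X by (auto simp: openin_open)
      then show ?thesis using W unfolding openin_open by (intro exI[of _ T]) blast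
    qed
    then show "openin (top_of_set ((f ^^ n) ` V)) (A \<inter> (f ^^ n) ` V)" "openin (top_of_set ((f ^^ n) ` V)) (B \<inter> (f ^^ n) ` V)"
      using AB(1,2) sub by blast+
  qed
  ultimately show False
    using AB(3,4) unfolding connected_openin by blast
qed

text \<open>The bounded open set in question is \<open>inside K\<close>: its image under an iterate
  is bounded and so cannot contain \<open>U\<close>, whereas the blow-up makes it meet
  \<open>U\<close>.\<close>

lemma julia_set_outside_compact:
  assumes te: "transcendental_entire f" and U: "U \<in> components (fatou_set f)" "\<not> bounded U"
    and K: "compact K" "K \<subseteq> julia_set f" and p: "p \<in> julia_set f" "p \<notin> K"
  shows "p \<in> outside K"
proof (rule ccontr)
  assume "p \<notin> outside K"
  then have p: "p \<in> inside K" using p(2) inside_Un_outside[of K] by blast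
  note hol = transcendental_entireD(1)[OF te]
  define G where "G = inside K"
  have "open G" "bounded G" unfolding G_def using K(1) by (auto intro: open_inside bounded_inside compact_imp_closed compact_imp_bounded)
  have Uo: "open U" "connected U" "U \<noteq> {}" "U \<subseteq> fatou_set f"
    using U open_components[OF open_fatou_set] in_components_connected in_components_nonempty in_components_subset by blast+
  obtain x where x: "x \<in> U" using Uo by auto
  obtain e where e: "0 < e" "ball x e \<subseteq> U" using Uo x openE by blast
  \<comment> \<open>A second point of \<open>U\<close> is needed because the blow-up may miss
    one.\<close>
  define y where "y = x + of_real (e/2)"
  have y: "y \<in> U" "y \<noteq> x" using e by (auto simp: y_def dist_norm intro!: subsetD[OF e(2)])
  obtain d where d: "0 < d" "ball p d \<subseteq> G" using \<open>open G\<close> p openE unfolding G_def by blast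
  obtain n where n: "\<And>a b. a \<in> {x, y} \<Longrightarrow> b \<in> {x, y} \<Longrightarrow> a \<noteq> b \<Longrightarrow> a \<in> (f ^^ n) ` ball p d \<or> b \<in> (f ^^ n) ` ball p d"
    by (rule julia_set_blow_up[OF te assms(6) open_ball connected_ball, of p d "{x, y}"]) (use d in auto)
  have "x \<in> (f ^^ n) ` ball p d \<or> y \<in> (f ^^ n) ` ball p d" by (rule n) (use y in auto)
  then have "U \<inter> (f ^^ n) ` G \<noteq> {}" using y(1) x image_mono[OF d(2), of "f ^^ n"] by auto
  moreover have "bounded ((f ^^ n) ` G)"
    using compact_imp_bounded[OF compact_continuous_image[OF continuous_on_funpow_holomorphic[OF hol], of "closure G"]] \<open>bounded G\<close>
    by (meson bounded_subset closure_subset compact_closure image_mono)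
  then have "U - (f ^^ n) ` G \<noteq> {}" using U(2) bounded_subset by blast
  ultimately have "U \<inter> frontier ((f ^^ n) ` G) \<noteq> {}" by (rule connected_Int_frontier[OF Uo(2)])
  moreover have "frontier ((f ^^ n) ` G) \<subseteq> (f ^^ n) ` frontier G"
    by (intro frontier_continuous_image continuous_on_funpow_holomorphic hol \<open>bounded G\<close> open_image_funpow[OF te \<open>open G\<close>])
  moreover have "frontier G \<subseteq> julia_set f"
    unfolding G_def using frontier_inside_subset[OF compact_imp_closed[OF K(1)]] K(2) by blast
  ultimately obtain z where "z \<in> U" "z \<in> julia_set f" using julia_set_iff[OF te] by blast
  then show False using Uo(4) by (auto simp: julia_set_def)
qed

subsection \<open>Theta-shaped configurations\<close>

lemma exp_eq_one_obtain:
  fixes z :: complex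
  assumes "exp z = 1"
  obtains n :: int where "z = of_int (2 * n) * (of_real pi * \<i>)"
proof -
  obtain n :: int where "Re z = 0" "Im z = of_int (2 * n) * pi"
    using assms by (auto simp: exp_eq_1)
  then have "z = of_int (2 * n) * (of_real pi * \<i>)"
    by (simp add: complex_eq_iff)
  then show thesis using that by blast
qed

text \<open>Two continuous logarithms along a path differ by a continuous function with values in
  the discrete set 2 pi i Z, hence by a constant. So each of them computes the winding number, even
  if the path is not closed.\<close>

lemma winding_number_log_increment:
  assumes "path \<gamma>" and q: "continuous_on {0..1} q"
    and eq: "\<And>t. t \<in> {0..1} \<Longrightarrow> exp (q t) = \<gamma> t - \<zeta>"
  shows "q 1 - q 0 = 2 * of_real pi * \<i> * winding_number \<gamma> \<zeta>"
proof -
  have "\<zeta> \<notin> path_image \<gamma>"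
    using eq by (force simp: path_image_def)
  then obtain p where p: "path p"
      "pathfinish p - pathstart p = 2 * of_real pi * \<i> * winding_number \<gamma> \<zeta>"
      "\<And>t. t \<in> {0..1} \<Longrightarrow> \<gamma> t = \<zeta> + exp (p t)"
    using winding_number_as_continuous_log[OF assms(1)] by metis
  have 1: "exp (q t - p t) = 1" if "t \<in> {0..1}" for t
    using eq[OF that] p(3)[OF that] by (simp add: exp_diff)
  have "(\<lambda>t. q t - p t) constant_on {0..1}"
  proof (rule continuous_discrete_range_constant)
    show "continuous_on {0..1} (\<lambda>t. q t - p t)"
      using q p(1) by (intro continuous_intros) (auto simp: path_def)
    show "\<exists>e>0. \<forall>y. y \<in> {0..1} \<and> q y - p y \<noteq> q x - p x \<longrightarrow> e \<le> norm ((q y - p y) - (q x - p x))"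
      if x: "x \<in> {0..1}" for x :: real
    proof (intro exI conjI allI impI)
      fix y :: real assume y: "y \<in> {0..1} \<and> q y - p y \<noteq> q x - p x"
      obtain m :: int where m: "q x - p x = of_int (2 * m) * (of_real pi * \<i>)"
        by (rule exp_eq_one_obtain[OF 1[OF x]])
      obtain n :: int where n: "q y - p y = of_int (2 * n) * (of_real pi * \<i>)"
        by (rule exp_eq_one_obtain[OF 1[of y]]) (use y in simp_all)
      then have "m \<noteq> n" using y m by metis
      have eq: "(q y - p y) - (q x - p x) = of_real (2 * pi * of_int (n - m)) * \<i>"
        unfolding m n by (simp add: algebra_simps)
      have "norm ((q y - p y) - (q x - p x)) = 2 * pi * of_int \<bar>n - m\<bar>"
        unfolding eq norm_mult norm_ii norm_of_real by (simp add: abs_mult)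
      also have "\<dots> \<ge> 2 * pi * 1"
        using \<open>m \<noteq> n\<close> by (intro mult_left_mono) auto
      finally show "2 * pi \<le> norm ((q y - p y) - (q x - p x))" by simp
    qed auto
  qed auto
  then have "q 1 - p 1 = q 0 - p 0"
    unfolding constant_on_def by force
  then show ?thesis using p(2) by (simp add: pathstart_def pathfinish_def algebra_simps)
qed

text \<open>Adding pi i changes the sign under the exponential. In this form a single logarithm of
  the difference of two paths serves both of them.\<close>

lemma winding_number_log_increment':
  assumes "path \<gamma>" and q: "continuous_on {0..1} q"
    and eq: "\<And>t. t \<in> {0..1} \<Longrightarrow> exp (q t) = \<zeta> - \<gamma> t"
  shows "q 1 - q 0 = 2 * of_real pi * \<i> * winding_number \<gamma> \<zeta>"
proof -
  have "(\<lambda>t. q t + of_real pi * \<i>) 1 - (\<lambda>t. q t + of_real pi * \<i>) 0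
     = 2 * of_real pi * \<i> * winding_number \<gamma> \<zeta>"
    by (rule winding_number_log_increment[OF assms(1)])
       (auto intro!: continuous_intros q simp: exp_add eq)
  then show ?thesis by simp
qed

text \<open>Both sides compare the increments of a logarithm of \<open>\<alpha> s - \<beta> t\<close> along the sides of the unit square.\<close>

lemma winding_number_disjoint_paths:
  assumes "path \<alpha>" "path \<beta>" and dis: "path_image \<alpha> \<inter> path_image \<beta> = {}"
  shows "winding_number \<alpha> (pathstart \<beta>) - winding_number \<beta> (pathstart \<alpha>)
       = winding_number \<alpha> (pathfinish \<beta>) - winding_number \<beta> (pathfinish \<alpha>)"
    and "exp (2 * of_real pi * \<i> * (winding_number \<alpha> (pathstart \<beta>) - winding_number \<beta> (pathstart \<alpha>)))
       = (pathfinish \<alpha> - pathstart \<beta>) / (pathstart \<alpha> - pathfinish \<beta>)"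
proof -
  define S where "S = cbox (0::real, 0::real) (1, 1)"
  have S: "S = {0..1} \<times> {0..1}"
    unfolding S_def cbox_Pair_eq by (simp add: cbox_interval)
  have nz: "\<alpha> t \<noteq> \<beta> s" if "t \<in> {0..1}" "s \<in> {0..1}" for s t
    using dis that unfolding path_image_def by blast
  have ca: "continuous_on {0..1} \<alpha>" and cb: "continuous_on {0..1} \<beta>"
    using assms by (auto simp: path_def)
  have "continuous_on S (\<lambda>z. \<alpha> (fst z) - \<beta> (snd z))"
    unfolding S by (intro continuous_intros continuous_on_compose2[OF ca] continuous_on_compose2[OF cb]) auto
  moreover have "contractible S"
    unfolding S_def by (intro convex_imp_contractible convex_box)
  moreover have "\<alpha> (fst z) - \<beta> (snd z) \<noteq> 0" if "z \<in> S" for z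
    using that nz[of "fst z" "snd z"] by (auto simp: S)
  ultimately obtain L where L: "continuous_on S L" "\<And>z. z \<in> S \<Longrightarrow> \<alpha> (fst z) - \<beta> (snd z) = exp (L z)"
    by (rule continuous_logarithm_on_contractible) blast+
  have cont: "continuous_on {0..1} (\<lambda>t. L (t, s))" "continuous_on {0..1} (\<lambda>t. L (s, t))"
    if "s \<in> {0..1}" for s
    using that by (auto intro!: continuous_on_compose2[OF L(1)] continuous_intros simp: S)
  have h: "L (1, s) - L (0, s) = 2 * of_real pi * \<i> * winding_number \<alpha> (\<beta> s)" if "s \<in> {0..1}" for s
    by (rule winding_number_log_increment[OF assms(1) cont(1)[OF that]])
       (use that L(2)[of "(_, s)"] in \<open>auto simp: S\<close>)
  have v: "L (t, 1) - L (t, 0) = 2 * of_real pi * \<i> * winding_number \<beta> (\<alpha> t)" if "t \<in> {0..1}" for t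
    by (rule winding_number_log_increment'[OF assms(2) cont(2)[OF that]])
       (use that L(2)[of "(t, _)"] in \<open>auto simp: S\<close>)
  have "2 * of_real pi * \<i> * (winding_number \<alpha> (\<beta> 0) - winding_number \<beta> (\<alpha> 0))
      = 2 * of_real pi * \<i> * (winding_number \<alpha> (\<beta> 1) - winding_number \<beta> (\<alpha> 1))"
    unfolding right_diff_distrib using h[of 0] h[of 1] v[of 0] v[of 1] by (simp add: algebra_simps)
  then show "winding_number \<alpha> (pathstart \<beta>) - winding_number \<beta> (pathstart \<alpha>)
       = winding_number \<alpha> (pathfinish \<beta>) - winding_number \<beta> (pathfinish \<alpha>)"
    by (simp add: pathstart_def pathfinish_def)
  \<comment> \<open>The sides through the corner (0,0) join (0,1) to (1,0); the exponentials of
    \<open>L\<close> at these corners are the denominator and the numerator of the claim.\<close>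
  have "2 * of_real pi * \<i> * (winding_number \<alpha> (\<beta> 0) - winding_number \<beta> (\<alpha> 0)) = L (1, 0) - L (0, 1)"
    unfolding right_diff_distrib using h[of 0] v[of 0] by (simp add: algebra_simps)
  then show "exp (2 * of_real pi * \<i> * (winding_number \<alpha> (pathstart \<beta>) - winding_number \<beta> (pathstart \<alpha>)))
       = (pathfinish \<alpha> - pathstart \<beta>) / (pathstart \<alpha> - pathfinish \<beta>)"
    using L(2)[of "(1,0)"] L(2)[of "(0,1)"] by (simp add: pathstart_def pathfinish_def exp_diff S)
qed

text \<open>Out along one pair and back along the other is a closed loop in \<open>Z\<close>, and
  its winding number about a point of \<open>outside Z\<close> vanishes.\<close>

lemma winding_number_theta_loop:
  assumes "path \<alpha>" "path \<beta>" "path \<alpha>'" "path \<beta>'"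
    and "pathfinish \<alpha> = pathstart \<beta>" "pathfinish \<alpha>' = pathstart \<beta>'"
    and "pathstart \<alpha> = pathstart \<alpha>'" "pathfinish \<beta> = pathfinish \<beta>'"
    and "path_image \<alpha> \<union> path_image \<beta> \<union> path_image \<alpha>' \<union> path_image \<beta>' \<subseteq> Z"
    and p: "p \<in> outside Z"
  shows "winding_number \<alpha> p + winding_number \<beta> p = winding_number \<alpha>' p + winding_number \<beta>' p"
proof -
  let ?g = "(\<alpha> +++ \<beta>) +++ reversepath (\<alpha>' +++ \<beta>')"
  have "p \<notin> Z" using p outside_no_overlap by blast
  then have nin: "p \<notin> path_image \<alpha>" "p \<notin> path_image \<beta>" "p \<notin> path_image \<alpha>'" "p \<notin> path_image \<beta>'"
    using assms by auto
  have "path_image ?g \<subseteq> Z"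
    using assms by (auto simp: path_image_join)
  then have "p \<in> outside (path_image ?g)"
    using p outside_mono by blast
  moreover have "path ?g" "pathfinish ?g = pathstart ?g"
    using assms by auto
  ultimately have "winding_number ?g p = 0"
    by (rule_tac winding_number_zero_in_outside)
  also have "winding_number ?g p = winding_number (\<alpha> +++ \<beta>) p + winding_number (reversepath (\<alpha>' +++ \<beta>')) p"
    using assms nin by (intro winding_number_join) (auto simp: path_image_join)
  also have "winding_number (reversepath (\<alpha>' +++ \<beta>')) p = - winding_number (\<alpha>' +++ \<beta>') p"
    using assms nin by (intro winding_number_reversepath) (auto simp: path_image_join)
  also have "winding_number (\<alpha>' +++ \<beta>') p = winding_number \<alpha>' p + winding_number \<beta>' p"
    using assms nin by (intro winding_number_join) auto
  also have "winding_number (\<alpha> +++ \<beta>) p = winding_number \<alpha> p + winding_number \<beta> p"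
    using assms nin by (intro winding_number_join) auto
  finally show ?thesis by (simp add: algebra_simps)
qed

text \<open>Here \<open>exp (2 \<pi> \<i> x\<^sub>i\<^sub>j) = (p\<^sub>j - p\<^sub>i) / (a - b)\<close>, so \<open>d\<^sub>i\<^sub>j = x\<^sub>i\<^sub>j - x\<^sub>j\<^sub>i\<close> is half an odd integer.
  If \<open>p\<^sub>i\<close> is outside the loop formed by the branches \<open>j\<close> and \<open>k\<close>, then \<open>d\<^sub>i\<^sub>j = d\<^sub>i\<^sub>k\<close>; together
  with antisymmetry this forces \<open>d = 0\<close>.\<close>

lemma theta_curve_not_all_outside:
  fixes \<alpha> \<beta> :: "nat \<Rightarrow> real \<Rightarrow> complex"
  assumes pa: "\<And>i. i < 3 \<Longrightarrow> path (\<alpha> i)" and pb: "\<And>i. i < 3 \<Longrightarrow> path (\<beta> i)"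
    and sa: "\<And>i. i < 3 \<Longrightarrow> pathstart (\<alpha> i) = a" and fb: "\<And>i. i < 3 \<Longrightarrow> pathfinish (\<beta> i) = b"
    and fa: "\<And>i. i < 3 \<Longrightarrow> pathfinish (\<alpha> i) = p i" and sb: "\<And>i. i < 3 \<Longrightarrow> pathstart (\<beta> i) = p i"
    and dis: "\<And>i j. i < 3 \<Longrightarrow> j < 3 \<Longrightarrow> i \<noteq> j \<Longrightarrow> path_image (\<alpha> i) \<inter> path_image (\<beta> j) = {}"
    and out: "\<And>i. i < 3 \<Longrightarrow> p i \<in> outside (Z i)"
    and sub: "\<And>i j. i < 3 \<Longrightarrow> j < 3 \<Longrightarrow> i \<noteq> j \<Longrightarrow> path_image (\<alpha> j) \<union> path_image (\<beta> j) \<subseteq> Z i"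
  shows False
proof -
  define x where "x i j = winding_number (\<alpha> j) (p i) - winding_number (\<beta> i) a" for i j
  define d where "d i j = x i j - x j i" for i j
  have x': "x i j = winding_number (\<alpha> j) b - winding_number (\<beta> i) (p j)"
    and ex: "exp (2 * of_real pi * \<i> * x i j) = (p j - p i) / (a - b)"
    if "i < 3" "j < 3" "i \<noteq> j" for i j
    using winding_number_disjoint_paths[of "\<alpha> j" "\<beta> i"] dis[of j i] that
    unfolding x_def by (simp_all add: pa pb sa sb fa fb)
  have key: "d i j = d i k" if "i < 3" "j < 3" "k < 3" "i \<noteq> j" "i \<noteq> k" for i j k
  proof -
    have "winding_number (\<alpha> j) (p i) + winding_number (\<beta> j) (p i)
        = winding_number (\<alpha> k) (p i) + winding_number (\<beta> k) (p i)"
      using that sub[of i j] sub[of i k] out[of i]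
      by (intro winding_number_theta_loop[where Z = "Z i"]) (simp_all add: pa pb sa sb fa fb)
    \<comment> \<open>With \<open>x j i\<close> expressed through the opposite ends of its paths,
      \<open>d i j\<close> becomes the sum above for \<open>j\<close> minus
      \<open>winding_number (\<beta> i) a + winding_number (\<alpha> i) b\<close>, which does not
      involve \<open>j\<close>.\<close>
    then show ?thesis
      using x'[of j i] x'[of k i] that unfolding d_def x_def by auto
  qed
  \<comment> \<open>Alternating with antisymmetry: d 0 1 = d 0 2 = - d 2 0 = - d 2 1 = d 1 2 = d 1 0
    = - d 0 1.\<close>
  have "d 0 1 = d 0 2" "d 1 2 = d 1 0" "d 2 0 = d 2 1"
    by (rule key; simp)+
  moreover have "d 1 0 = - d 0 1" "d 2 0 = - d 0 2" "d 2 1 = - d 1 2"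
    by (simp_all add: d_def)
  ultimately have "d 0 1 = 0" by simp
  then have "x 0 1 = x 1 0" by (simp add: d_def)
  then have "(p 1 - p 0) / (a - b) = (p 0 - p 1) / (a - b)"
    using ex[of 0 1] ex[of 1 0] by simp
  moreover have "a \<noteq> b"
    using dis[of 0 1] pathstart_in_path_image[of "\<alpha> 0"] pathfinish_in_path_image[of "\<beta> 1"]
    by (simp add: sa fb disjoint_iff) metis
  moreover have "p 0 \<noteq> p 1"
    using dis[of 0 1] pathfinish_in_path_image[of "\<alpha> 0"] pathstart_in_path_image[of "\<beta> 1"]
    by (simp add: fa sb disjoint_iff) metis
  ultimately show False by (auto simp: field_simps)
qed

text \<open>The pieces of the Julia set at hand are compact and connected; their thickenings are
  moreover path connected, so the branches can be joined inside them.\<close>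

lemma path_connected_closed_nhd:
  fixes A :: "complex set"
  assumes "connected A" "0 < e"
  shows "path_connected (\<Union>a\<in>A. cball a e)"
proof -
  let ?N = "\<Union>a\<in>A. cball a e"
  have pc: "path_connected (\<Union>a\<in>A. ball a e)"
    by (intro connected_open_path_connected connected_nhd assms) auto
  have sub: "(\<Union>a\<in>A. ball a e) \<subseteq> ?N" by (intro UN_mono) auto
  have seg: "path_component ?N z a" if "a \<in> A" "z \<in> cball a e" for a z
  proof (rule path_component_of_subset)
    show "path_component (cball a e) z a"
      using that assms(2) convex_imp_path_connected[OF convex_cball, of a e]
      unfolding path_connected_component by auto
  qed (use that in auto)
  show ?thesis
    unfolding path_connected_component
  proof (intro ballI)
    fix x y assume "x \<in> ?N" "y \<in> ?N"
    then obtain a b where ab: "a \<in> A" "x \<in> cball a e" "b \<in> A" "y \<in> cball b e" by blast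
    have "a \<in> (\<Union>a\<in>A. ball a e)" "b \<in> (\<Union>a\<in>A. ball a e)" using ab assms(2) by force+
    then have "path_component ?N a b"
      using pc path_component_of_subset[OF sub] unfolding path_connected_component by blast
    then show "path_component ?N x y"
      using seg[OF ab(1,2)] seg[OF ab(3,4)] path_component_trans path_component_sym by metis
  qed
qed

text \<open>\<open>u\<close> is the last visit to \<open>A\<close>, and \<open>v\<close> the first
  visit to \<open>B\<close> from then on.\<close>

lemma trim_path:
  fixes q :: "real \<Rightarrow> complex"
  assumes q: "continuous_on {0..T} q" "0 \<le> T" "q 0 \<in> A" "q T \<in> B"
    and AB: "closed A" "closed B" "A \<inter> B = {}"
  obtains u v where "0 \<le> u" "u < v" "v \<le> T" "q u \<in> A" "q v \<in> B"
    "\<And>t. u < t \<Longrightarrow> t \<le> v \<Longrightarrow> q t \<notin> A" "\<And>t. u \<le> t \<Longrightarrow> t < v \<Longrightarrow> q t \<notin> B"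
proof -
  define EA where "EA = {0..T} \<inter> q -` A"
  have "closed EA" unfolding EA_def by (intro continuous_closed_preimage q AB) auto
  moreover have "bounded EA" by (rule bounded_subset[of "{0..T}"]) (auto simp: EA_def)
  moreover have "0 \<in> EA" using q by (auto simp: EA_def)
  ultimately obtain u where u: "u \<in> EA" "\<And>t. t \<in> EA \<Longrightarrow> t \<le> u"
    using compact_attains_sup[of EA] by (auto simp: compact_eq_bounded_closed)
  define EB where "EB = {u..T} \<inter> q -` B"
  have "closed EB" unfolding EB_def using u(1)
    by (intro continuous_closed_preimage continuous_on_subset[OF q(1)] AB) (auto simp: EA_def)
  moreover have "bounded EB" by (rule bounded_subset[of "{u..T}"]) (auto simp: EB_def)
  moreover have "T \<in> EB" using q u(1) by (auto simp: EB_def EA_def)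
  ultimately obtain v where v: "v \<in> EB" "\<And>t. t \<in> EB \<Longrightarrow> v \<le> t"
    using compact_attains_inf[of EB] by (auto simp: compact_eq_bounded_closed)
  have "u \<noteq> v" using u(1) v(1) AB(3) by (auto simp: EA_def EB_def)
  show thesis
  proof (rule that[of u v])
    show "q t \<notin> A" if "u < t" "t \<le> v" for t
    proof
      assume "q t \<in> A"
      then have "t \<in> EA" using that u(1) v(1) by (auto simp: EA_def EB_def)
      then show False using u(2)[of t] that by simp
    qed
    show "q t \<notin> B" if "u \<le> t" "t < v" for t
    proof
      assume "q t \<in> B"
      then have "t \<in> EB" using that v(1) by (auto simp: EB_def)
      then show False using v(2)[of t] that by simp
    qed
  qed (use u v \<open>u \<noteq> v\<close> in \<open>auto simp: EA_def EB_def\<close>)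
qed

text \<open>Branch \<open>i\<close> of the theta curve runs in \<open>A\<close>, along the trimmed
  \<open>q i\<close>, and in \<open>B\<close>; it is split where it crosses the circle of radius
  \<open>r\<close>. The conditions on \<open>Z\<close> are demanded at every crossing time because
  the one in use is found only after trimming, by the intermediate value theorem.\<close>

lemma three_crossings_impossible:
  fixes q :: "nat \<Rightarrow> real \<Rightarrow> complex" and T :: "nat \<Rightarrow> real"
  assumes A: "path_connected A" "closed A" "A \<subseteq> ball z0 r"
    and B: "path_connected B" "closed B" "B \<inter> cball z0 r = {}"
    and q: "\<And>i. i < 3 \<Longrightarrow> continuous_on {0..T i} (q i)" "\<And>i. i < 3 \<Longrightarrow> 0 \<le> T i"
      "\<And>i. i < 3 \<Longrightarrow> q i 0 \<in> A" "\<And>i. i < 3 \<Longrightarrow> q i (T i) \<in> B"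
    and dis: "\<And>i j s t. i < 3 \<Longrightarrow> j < 3 \<Longrightarrow> i \<noteq> j \<Longrightarrow> s \<in> {0..T i} \<Longrightarrow> t \<in> {0..T j} \<Longrightarrow> q i s \<noteq> q j t"
    and out: "\<And>i t. i < 3 \<Longrightarrow> t \<in> {0..T i} \<Longrightarrow> dist z0 (q i t) = r \<Longrightarrow> q i t \<in> outside (Z i t)"
    and AZ: "\<And>i t. i < 3 \<Longrightarrow> t \<in> {0..T i} \<Longrightarrow> dist z0 (q i t) = r \<Longrightarrow> A \<union> B \<subseteq> Z i t"
    and qZ: "\<And>i j s t. i < 3 \<Longrightarrow> j < 3 \<Longrightarrow> i \<noteq> j \<Longrightarrow> s \<in> {0..T j} \<Longrightarrow> t \<in> {0..T i} \<Longrightarrow>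
        dist z0 (q i t) = r \<Longrightarrow> q j s \<in> Z i t"
  shows False
proof -
  have AB: "A \<inter> B = {}"
  proof -
    have "A \<subseteq> cball z0 r" using A(3) ball_subset_cball by blast
    then show ?thesis using B(3) by blast
  qed
  define Q where "Q i u v \<tau> \<longleftrightarrow> 0 \<le> u \<and> u < \<tau> \<and> \<tau> < v \<and> v \<le> T i \<and> q i u \<in> A \<and> q i v \<in> B \<and>
      dist z0 (q i \<tau>) = r \<and> (\<forall>t. u < t \<longrightarrow> t \<le> v \<longrightarrow> q i t \<notin> A) \<and> (\<forall>t. u \<le> t \<longrightarrow> t < v \<longrightarrow> q i t \<notin> B)"
    for i u v \<tau>
  have "\<exists>u v \<tau>. Q i u v \<tau>" if i: "i < 3" for i
  proof -
    obtain u v where uv: "0 \<le> u" "u < v" "v \<le> T i" "q i u \<in> A" "q i v \<in> B"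
      "\<And>t. u < t \<Longrightarrow> t \<le> v \<Longrightarrow> q i t \<notin> A" "\<And>t. u \<le> t \<Longrightarrow> t < v \<Longrightarrow> q i t \<notin> B"
      by (rule trim_path[OF q(1-4)[OF i] A(2) B(2) AB]) blast
    have "dist z0 (q i u) < r" using uv(4) A(3) by auto
    moreover have "r < dist z0 (q i v)" using uv(5) B(3) by fastforce
    moreover have "continuous_on {u..v} (\<lambda>t. dist z0 (q i t))"
      using uv by (intro continuous_intros continuous_on_subset[OF q(1)[OF i]]) auto
    ultimately obtain \<tau> where \<tau>: "u \<le> \<tau>" "\<tau> \<le> v" "dist z0 (q i \<tau>) = r"
      using IVT'[of "\<lambda>t. dist z0 (q i t)" u r v] uv(2) by auto
    then have "\<tau> \<noteq> u" "\<tau> \<noteq> v" using \<open>dist z0 (q i u) < r\<close> \<open>r < dist z0 (q i v)\<close> by auto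
    with uv \<tau> have "Q i u v \<tau>" unfolding Q_def by simp
    then show ?thesis by blast
  qed
  then obtain u v \<tau> where "\<And>i. i < 3 \<Longrightarrow> Q i (u i) (v i) (\<tau> i)" by metis
  then have uv: "\<And>i. i < 3 \<Longrightarrow> 0 \<le> u i" "\<And>i. i < 3 \<Longrightarrow> u i < \<tau> i" "\<And>i. i < 3 \<Longrightarrow> \<tau> i < v i"
    "\<And>i. i < 3 \<Longrightarrow> v i \<le> T i" "\<And>i. i < 3 \<Longrightarrow> q i (u i) \<in> A" "\<And>i. i < 3 \<Longrightarrow> q i (v i) \<in> B"
    "\<And>i. i < 3 \<Longrightarrow> dist z0 (q i (\<tau> i)) = r"
    "\<And>i t. i < 3 \<Longrightarrow> u i < t \<Longrightarrow> t \<le> v i \<Longrightarrow> q i t \<notin> A"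
    "\<And>i t. i < 3 \<Longrightarrow> u i \<le> t \<Longrightarrow> t < v i \<Longrightarrow> q i t \<notin> B"
    by (simp_all add: Q_def)
  obtain a b where ab: "a \<in> A" "b \<in> B" using uv(5,6)[of 0] by auto
  have "\<exists>g. path g \<and> path_image g \<subseteq> A \<and> pathstart g = a \<and> pathfinish g = q i (u i)" if "i < 3" for i
    using A(1) ab(1) uv(5)[OF that] unfolding path_connected_def by blast
  then obtain g where g: "\<And>i. i < 3 \<Longrightarrow> path (g i) \<and> path_image (g i) \<subseteq> A \<and> pathstart (g i) = a \<and> pathfinish (g i) = q i (u i)"
    by metis
  have "\<exists>g. path g \<and> path_image g \<subseteq> B \<and> pathstart g = q i (v i) \<and> pathfinish g = b" if "i < 3" for i
    using B(1) ab(2) uv(6)[OF that] unfolding path_connected_def by blast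
  then obtain h where h: "\<And>i. i < 3 \<Longrightarrow> path (h i) \<and> path_image (h i) \<subseteq> B \<and> pathstart (h i) = q i (v i) \<and> pathfinish (h i) = b"
    by metis
  have sp: "path (subpath s t (q i)) \<and> path_image (subpath s t (q i)) = q i ` {s..t} \<and>
      pathstart (subpath s t (q i)) = q i s \<and> pathfinish (subpath s t (q i)) = q i t"
    if "i < 3" "0 \<le> s" "s \<le> t" "t \<le> T i" for i s t
  proof -
    have "continuous_on {0..1} (\<lambda>x. q i ((t - s) * x + s))"
    proof (intro continuous_on_compose2[OF q(1)[OF that(1)]] continuous_intros image_subsetI)
      fix x :: real assume x: "x \<in> {0..1}"
      then have "(t - s) * x \<le> (t - s) * 1" using that by (intro mult_left_mono) auto
      moreover have "0 \<le> (t - s) * x" using x that by auto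
      ultimately show "(t - s) * x + s \<in> {0..T i}" using that by auto
    qed
    then show ?thesis
      using that by (auto simp: path_def subpath_def pathstart_def pathfinish_def
          path_image_subpath_gen[unfolded subpath_def] closed_segment_eq_real_ivl)
  qed
  define \<alpha> where "\<alpha> i = g i +++ subpath (u i) (\<tau> i) (q i)" for i
  define \<beta> where "\<beta> i = subpath (\<tau> i) (v i) (q i) +++ h i" for i
  have ord: "0 \<le> u i" "u i \<le> \<tau> i" "\<tau> i \<le> T i" "0 \<le> \<tau> i" "\<tau> i \<le> v i" "v i \<le> T i" if "i < 3" for i
    using uv(1-4)[OF that] by linarith+
  note sp1 = sp[OF _ ord(1) ord(2) ord(3)] and sp2 = sp[OF _ ord(4) ord(5) ord(6)]
  have im\<alpha>: "path_image (\<alpha> i) = path_image (g i) \<union> q i ` {u i..\<tau> i}" if "i < 3" for i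
    unfolding \<alpha>_def using sp1[OF that that that that] g[OF that] by (subst path_image_join) auto
  have im\<beta>: "path_image (\<beta> i) = q i ` {\<tau> i..v i} \<union> path_image (h i)" if "i < 3" for i
    unfolding \<beta>_def using sp2[OF that that that that] h[OF that] by (subst path_image_join) auto
  show False
  proof (rule theta_curve_not_all_outside[of \<alpha> \<beta> a b "\<lambda>i. q i (\<tau> i)" "\<lambda>i. Z i (\<tau> i)"])
    fix i :: nat assume i: "i < 3"
    show "path (\<alpha> i)" "pathstart (\<alpha> i) = a" "pathfinish (\<alpha> i) = q i (\<tau> i)"
      unfolding \<alpha>_def using sp1[OF i i i i] g[OF i] by auto
    show "path (\<beta> i)" "pathfinish (\<beta> i) = b" "pathstart (\<beta> i) = q i (\<tau> i)"
      unfolding \<beta>_def using sp2[OF i i i i] h[OF i] by auto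
    show "q i (\<tau> i) \<in> outside (Z i (\<tau> i))"
      using out[OF i _ uv(7)[OF i]] ord[OF i] by auto
    fix j :: nat assume j: "j < 3" "i \<noteq> j"
    show "path_image (\<alpha> i) \<inter> path_image (\<beta> j) = {}"
    proof -
      \<comment> \<open>Trimming settles the mixed pairs: after \<open>u j\<close> the path
        \<open>q j\<close> is off \<open>A\<close>, and before \<open>v i\<close> the path
        \<open>q i\<close> is off \<open>B\<close>.\<close>
      have "g' \<noteq> h'" if "g' \<in> A" "h' \<in> B" for g' h' using that AB by auto
      moreover have "q j t \<notin> A" if "t \<in> {\<tau> j..v j}" for t
        using uv(8)[OF j(1), of t] uv(2)[OF j(1)] that by auto
      moreover have "q i t \<notin> B" if "t \<in> {u i..\<tau> i}" for t
        using uv(9)[OF i, of t] uv(3)[OF i] that by auto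
      moreover have "q i s \<noteq> q j t" if "s \<in> {u i..\<tau> i}" "t \<in> {\<tau> j..v j}" for s t
        using that ord[OF i] ord[OF j(1)] by (intro dis[OF i j]) auto
      ultimately show ?thesis
        unfolding im\<alpha>[OF i] im\<beta>[OF j(1)] using g[OF i] h[OF j(1)] AB by blast
    qed
    have "q j t \<in> Z i (\<tau> i)" if "t \<in> {0..T j}" for t
      using ord[OF i] by (intro qZ[OF i j that _ uv(7)[OF i]]) auto
    moreover have "A \<union> B \<subseteq> Z i (\<tau> i)" using AZ[OF i _ uv(7)[OF i]] ord[OF i] by auto
    moreover have "{u j..\<tau> j} \<subseteq> {0..T j}" "{\<tau> j..v j} \<subseteq> {0..T j}" using ord[OF j(1)] by auto
    ultimately show "path_image (\<alpha> j) \<union> path_image (\<beta> j) \<subseteq> Z i (\<tau> i)"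
      unfolding im\<alpha>[OF j(1)] im\<beta>[OF j(1)] using g[OF j(1)] h[OF j(1)] by blast
  qed
qed


subsection \<open>Lifting paths under entire functions\<close>

text \<open>A Lebesgue number of a cover by sets of injectivity gives \<open>r\<close>, and a finite
  subcover gives \<open>e\<close>. Source discs of half the radius and target discs of twice the
  size allow the centre to move from \<open>x\<close> to a nearby \<open>y\<close>.\<close>

lemma uniform_local_inverse:
  assumes holg: "g holomorphic_on UNIV" and "compact X" and nz: "\<And>x. x \<in> X \<Longrightarrow> deriv g x \<noteq> 0"
  obtains r e where "0 < r" "0 < e" "\<And>x. x \<in> X \<Longrightarrow> inj_on g (ball x r)"
    "\<And>x. x \<in> X \<Longrightarrow> ball (g x) e \<subseteq> g ` ball x r"
proof -
  have cg: "continuous_on S g" for S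
    using holg holomorphic_on_imp_continuous_on holomorphic_on_subset by blast
  have "X \<subseteq> \<Union>{G. open G \<and> inj_on g G}"
  proof
    fix x assume "x \<in> X"
    then obtain s where "0 < s" "inj_on g (ball x s)"
      using has_complex_derivative_locally_injective[OF holg _ _ nz] by auto
    then show "x \<in> \<Union>{G. open G \<and> inj_on g G}" using centre_in_ball open_ball by blast
  qed
  then obtain r where r: "0 < r" "\<And>x. x \<in> X \<Longrightarrow> \<exists>G\<in>{G. open G \<and> inj_on g G}. ball x r \<subseteq> G"
    by (rule Heine_Borel_lemma[OF assms(2)]) auto
  have inj: "inj_on g (ball x r)" if "x \<in> X" for x
    using r(2)[OF that] by (auto intro: inj_on_subset)
  have "\<exists>s>0. ball (g x) (2 * s) \<subseteq> g ` ball x (r/2)" if x: "x \<in> X" for x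
  proof -
    have "open (g ` ball x (r/2))"
      by (rule open_mapping_thm3[of g])
         (use holg inj[OF x] r(1) in \<open>auto intro: holomorphic_on_subset inj_on_subset\<close>)
    moreover have "g x \<in> g ` ball x (r/2)" using r(1) by auto
    ultimately obtain s where "0 < s" "ball (g x) s \<subseteq> g ` ball x (r/2)" by (auto simp: open_contains_ball)
    then show ?thesis by (intro exI[of _ "s/2"]) auto
  qed
  then obtain s where s: "\<And>x. x \<in> X \<Longrightarrow> 0 < s x" "\<And>x. x \<in> X \<Longrightarrow> ball (g x) (2 * s x) \<subseteq> g ` ball x (r/2)"
    by metis
  define G where "G x = ball x (r/2) \<inter> g -` ball (g x) (s x)" for x
  have "open (G x)" for x
    unfolding G_def using continuous_open_preimage[OF cg[of "ball x (r/2)"]] by auto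
  moreover have "X \<subseteq> (\<Union>x\<in>X. G x)" using s(1) r(1) by (force simp: G_def)
  ultimately obtain D where D: "D \<subseteq> X" "finite D" "X \<subseteq> (\<Union>x\<in>D. G x)"
    using compactE_image[OF assms(2), of X G] by metis
  define e where "e = Min (insert 1 (s ` D))"
  have e: "0 < e" "\<And>x. x \<in> D \<Longrightarrow> e \<le> s x"
    using D s(1) by (auto simp: e_def subset_iff)
  have "ball (g y) e \<subseteq> g ` ball y r" if y: "y \<in> X" for y
  proof -
    obtain x where x: "x \<in> D" "y \<in> G x" using D y by auto
    have "ball (g y) e \<subseteq> ball (g x) (2 * s x)"
    proof
      fix z assume "z \<in> ball (g y) e"
      then have "dist (g x) z < s x + e"
        using x by (intro le_less_trans[OF dist_triangle[of _ _ "g y"]] add_strict_mono) (auto simp: G_def)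
      then show "z \<in> ball (g x) (2 * s x)" using e(2)[OF x(1)] by auto
    qed
    also have "\<dots> \<subseteq> g ` ball x (r/2)" using s(2) x D by auto
    also have "\<dots> \<subseteq> g ` ball y r"
    proof (intro image_mono subsetI)
      fix z assume "z \<in> ball x (r/2)"
      then have "dist y z < r/2 + r/2"
        using x by (intro le_less_trans[OF dist_triangle[of _ _ x]] add_strict_mono) (auto simp: G_def dist_commute)
      then show "z \<in> ball y r" by simp
    qed
    finally show ?thesis .
  qed
  with r(1) e(1) inj show thesis by (rule that)
qed

lemma local_inverse:
  assumes holg: "g holomorphic_on UNIV" and inj: "inj_on g (ball x r)"
    and "ball (g x) e \<subseteq> g ` ball x r"
  obtains h where "continuous_on (ball (g x) e) h"
    "\<And>w. w \<in> ball (g x) e \<Longrightarrow> h w \<in> ball x r \<and> g (h w) = w"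
    "\<And>z. z \<in> ball x r \<Longrightarrow> h (g z) = z"
proof -
  obtain h where h: "h holomorphic_on (g ` ball x r)" "\<And>z. z \<in> ball x r \<Longrightarrow> h (g z) = z"
    using holomorphic_has_inverse[OF holomorphic_on_subset[OF holg subset_UNIV] open_ball inj] by metis
  show thesis
  proof (rule that[OF _ _ h(2)])
    show "continuous_on (ball (g x) e) h"
      using h(1) assms(3) holomorphic_on_imp_continuous_on continuous_on_subset by blast
  qed (use h assms(3) in force)+
qed

text \<open>In the disc, \<open>u\<close> equals the local inverse \<open>h\<close> applied to
  \<open>g \<circ> u\<close>, and only there. Membership in the open disc is thus also a closed
  condition on the parameter.\<close>

lemma lift_stays_in_ball:
  fixes u :: "real \<Rightarrow> complex"
  assumes holg: "g holomorphic_on UNIV" and inj: "inj_on g (ball x r)"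
    and im: "ball (g x) e \<subseteq> g ` ball x r"
    and u: "continuous_on {a..b} u" "s \<in> {a..b}" "u s \<in> ball x r"
    and gu: "\<And>t. t \<in> {a..b} \<Longrightarrow> g (u t) \<in> ball (g x) e"
    and t: "t \<in> {a..b}"
  shows "u t \<in> ball x r"
proof -
  obtain h where h: "continuous_on (ball (g x) e) h"
    "\<And>w. w \<in> ball (g x) e \<Longrightarrow> h w \<in> ball x r \<and> g (h w) = w"
    "\<And>z. z \<in> ball x r \<Longrightarrow> h (g z) = z"
    using local_inverse[OF holg inj im] by metis
  have cg: "continuous_on UNIV g"
    using holg holomorphic_on_imp_continuous_on by blast
  have chu: "continuous_on {a..b} (\<lambda>t. h (g (u t)) - u t)"
    by (intro continuous_intros u continuous_on_compose2[OF h(1)] continuous_on_compose2[OF cg]) (use gu in auto)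
  define T where "T = {a..b} \<inter> u -` ball x r"
  have T: "T = {a..b} \<inter> (\<lambda>t. h (g (u t)) - u t) -` {0}"
    unfolding T_def using h(2,3) gu by (force simp: T_def)
  have "openin (top_of_set {a..b}) T"
    unfolding T_def using u(1) by (auto intro: continuous_openin_preimage_gen)
  moreover have "closedin (top_of_set {a..b}) T"
    unfolding T by (intro continuous_closedin_preimage chu) auto
  ultimately have "T = {} \<or> T = {a..b}"
    using connected_clopen[of "{a..b}"] by auto
  then show ?thesis using u t by (auto simp: T_def)
qed

lemma lift_unique:
  fixes u v :: "real \<Rightarrow> complex"
  assumes holg: "g holomorphic_on UNIV" and cont: "continuous_on {a..b} u" "continuous_on {a..b} v"
    and eq: "\<And>t. t \<in> {a..b} \<Longrightarrow> g (u t) = g (v t)"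
    and nz: "\<And>t. t \<in> {a..b} \<Longrightarrow> deriv g (u t) \<noteq> 0"
    and s: "s \<in> {a..b}" "u s = v s" and t: "t \<in> {a..b}"
  shows "u t = v t"
proof -
  define T where "T = {a..b} \<inter> (\<lambda>t. u t - v t) -` {0}"
  have "closedin (top_of_set {a..b}) T"
    unfolding T_def by (intro continuous_closedin_preimage continuous_intros cont)
  moreover have "openin (top_of_set {a..b}) T"
  proof (subst openin_subopen, intro ballI)
    fix t assume t: "t \<in> T"
    then obtain r where r: "0 < r" "inj_on g (ball (u t) r)"
      using has_complex_derivative_locally_injective[OF holg _ _ nz[of t]] by (auto simp: T_def)
    define W where "W = ({a..b} \<inter> u -` ball (u t) r) \<inter> ({a..b} \<inter> v -` ball (u t) r)"
    have "openin (top_of_set {a..b}) W"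
      unfolding W_def using cont by (intro openin_Int continuous_openin_preimage_gen) auto
    moreover have "t \<in> W" using t r(1) by (auto simp: W_def T_def)
    moreover have "W \<subseteq> T" using r(2) eq by (auto simp: W_def T_def inj_on_def)
    ultimately show "\<exists>W. openin (top_of_set {a..b}) W \<and> t \<in> W \<and> W \<subseteq> T" by blast
  qed
  ultimately have "T = {} \<or> T = {a..b}"
    using connected_clopen[of "{a..b}"] by auto
  then show ?thesis using s t by (auto simp: T_def)
qed

text \<open>The lift is continued by parameter steps of one length \<open>d\<close>, uniform because
  \<open>X\<close> is compact, until it reaches the sphere. It cannot survive to the end, since then
  \<open>c 1\<close> would be a value of \<open>g\<close> on the closed disc.\<close>

lemma lift_path_to_sphere:
  fixes c :: "real \<Rightarrow> complex"
  assumes holg: "g holomorphic_on UNIV" and "path c"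
    and nz: "\<And>z. z \<in> cball p R \<Longrightarrow> g z \<in> path_image c \<Longrightarrow> deriv g z \<noteq> 0"
    and b: "b \<in> ball p R" "g b = c 0" and far: "c 1 \<notin> g ` cball p R"
  obtains q T where "T \<in> {0..1}" "continuous_on {0..T} q" "q 0 = b" "q T \<in> sphere p R"
    "\<And>t. t \<in> {0..T} \<Longrightarrow> q t \<in> cball p R \<and> g (q t) = c t"
proof -
  define lift where "lift T q \<longleftrightarrow> continuous_on {0..T} q \<and> q 0 = b \<and>
      (\<forall>t\<in>{0..T}. q t \<in> cball p R \<and> g (q t) = c t)" for T q
  define good where "good \<longleftrightarrow> (\<exists>T q. T \<in> {0..1} \<and> lift T q \<and> q T \<in> sphere p R)"
  define X where "X = cball p R \<inter> g -` path_image c"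
  have cg: "continuous_on UNIV g"
    using holg holomorphic_on_imp_continuous_on by blast
  have "closed X"
    unfolding X_def using assms(2)
    by (intro continuous_closed_preimage continuous_on_subset[OF cg] closed_path_image) auto
  then have "compact X"
    unfolding X_def by (metis Int_lower1 bounded_cball bounded_subset compact_eq_bounded_closed)
  then obtain r e where r: "0 < r" "0 < e" "\<And>x. x \<in> X \<Longrightarrow> inj_on g (ball x r)"
    "\<And>x. x \<in> X \<Longrightarrow> ball (g x) e \<subseteq> g ` ball x r"
    using uniform_local_inverse[OF holg, of X] nz by (auto simp: X_def)
  have cc: "continuous_on {0..1} c" using assms(2) by (simp add: path_def)
  then have "uniformly_continuous_on {0..1} c"
    by (intro compact_uniformly_continuous) auto
  then obtain d0 where d0: "0 < d0" "\<And>s t. s \<in> {0..1} \<Longrightarrow> t \<in> {0..1} \<Longrightarrow> dist t s < d0 \<Longrightarrow> dist (c t) (c s) < e"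
    using r(2) unfolding uniformly_continuous_on_def by metis
  define d where "d = d0 / 2"
  have d: "0 < d" "\<And>s t. s \<in> {0..1} \<Longrightarrow> t \<in> {0..1} \<Longrightarrow> \<bar>t - s\<bar> \<le> d \<Longrightarrow> dist (c s) (c t) < e"
    using d0(1) d0(2)[of t s for s t] by (auto simp: d_def dist_real_def dist_commute abs_minus_commute)
  have step: "good \<or> (\<exists>q. lift (min 1 (T + d)) q)" if T: "T \<in> {0..1}" and q: "lift T q" for T q
  proof -
    define x where "x = q T"
    have x: "x \<in> X" "g x = c T" "x \<in> cball p R"
      using q T by (auto simp: x_def lift_def X_def path_image_def)
    obtain h where h: "continuous_on (ball (g x) e) h"
      "\<And>w. w \<in> ball (g x) e \<Longrightarrow> h w \<in> ball x r \<and> g (h w) = w"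
      "\<And>z. z \<in> ball x r \<Longrightarrow> h (g z) = z"
      using local_inverse[OF holg r(3,4)[OF x(1)]] by metis
    define T1 where "T1 = min 1 (T + d)"
    have T1: "T \<le> T1" "T1 \<le> 1" "\<And>t. t \<in> {T..T1} \<Longrightarrow> c t \<in> ball (g x) e"
      using T d(1) d(2)[of T] by (auto simp: T1_def x(2))
    define q' where "q' t = (if t \<le> T then q t else h (c t))" for t
    have "continuous_on ({0..T} \<union> {T..T1}) q'"
      unfolding q'_def
    proof (rule continuous_on_If)
      show "continuous_on {0..T} q" using q by (simp add: lift_def)
      show "continuous_on {T..T1} (\<lambda>t. h (c t))"
        using T1 T by (intro continuous_on_compose2[OF h(1)] continuous_on_subset[OF cc]) auto
      fix t assume "t \<in> {0..T}" "\<not> t \<le> T" then show "q t = h (c t)" by simp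
    next
      fix t assume "t \<in> {T..T1}" "t \<le> T"
      then have "t = T" by simp
      then show "q t = h (c t)" using h(3)[of x] r(1) x(2) by (simp add: x_def)
    qed auto
    moreover have "{0..T} \<union> {T..T1} = {0..T1}" using T T1 by auto
    ultimately have cq': "continuous_on {0..T1} q'" by simp
    have q'0: "q' 0 = b" using q T by (simp add: q'_def lift_def)
    have gq': "g (q' t) = c t" if "t \<in> {0..T1}" for t
      using that q h(2)[OF T1(3)[of t]] by (auto simp: q'_def lift_def)
    \<comment> \<open>The times when the extended lift is outside the open disc. At the first of
      them it is on the sphere, and it is cut there.\<close>
    define E where "E = {0..T1} \<inter> q' -` (- ball p R)"
    show ?thesis
    proof (cases "E = {}")
      case True
      then have "lift T1 q'"
        using cq' q'0 gq' by (force simp: lift_def E_def)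
      then show ?thesis unfolding T1_def by blast
    next
      case False
      have "closed E"
        unfolding E_def by (intro continuous_closed_preimage cq') auto
      moreover have "bounded E" by (rule bounded_subset[of "{0..T1}"]) (auto simp: E_def)
      ultimately obtain t where t: "t \<in> E" and min: "\<And>s. s \<in> E \<Longrightarrow> t \<le> s"
        using compact_attains_inf[of E] False by (auto simp: compact_eq_bounded_closed)
      have "0 < t" using t q'0 b(1) by (cases "t = 0") (auto simp: E_def)
      have in_ball: "q' s \<in> ball p R" if "s \<in> {0..<t}" for s
        using min[of s] that t by (auto simp: E_def)
      have "q' t \<in> cball p R"
      proof (rule ccontr)
        assume n: "q' t \<notin> cball p R"
        have "continuous_on {0..t} (\<lambda>s. dist p (q' s))"
          using t by (intro continuous_intros continuous_on_subset[OF cq']) (auto simp: E_def)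
        then obtain s where s: "0 \<le> s" "s \<le> t" "dist p (q' s) = R"
          using IVT'[of "\<lambda>s. dist p (q' s)" 0 R t] q'0 b(1) n \<open>0 < t\<close> by auto
        then show False using in_ball[of s] n by (cases "s = t") auto
      qed
      then have "q' t \<in> sphere p R" using t by (auto simp: E_def)
      moreover have "lift t q'"
        unfolding lift_def
      proof (intro conjI ballI)
        show "continuous_on {0..t} q'" using t by (intro continuous_on_subset[OF cq']) (auto simp: E_def)
        fix s assume s: "s \<in> {0..t}"
        then show "q' s \<in> cball p R" using in_ball[of s] \<open>q' t \<in> cball p R\<close> by (cases "s = t") auto
        show "g (q' s) = c s" using s t by (intro gq') (auto simp: E_def)
      qed (rule q'0)
      ultimately have good
        unfolding good_def using t T1 \<open>0 < t\<close> by (intro exI[of _ t] exI[of _ q']) (auto simp: E_def)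
      then show ?thesis ..
    qed
  qed
  have all: "good \<or> (\<exists>q. lift (min 1 (real n * d)) q)" for n
  proof (induction n)
    case 0
    have "lift 0 (\<lambda>_. b)" using b by (auto simp: lift_def)
    then show ?case by auto
  next
    case (Suc n)
    have "min 1 (min 1 (real n * d) + d) = min 1 (real (Suc n) * d)"
      using d(1) by (auto simp: min_def algebra_simps)
    then show ?case using Suc step[of "min 1 (real n * d)"] d(1) by auto
  qed
  obtain n :: nat where "1 / d < real n" using reals_Archimedean2 by blast
  then have "min 1 (real n * d) = 1" using d(1) by (auto simp: field_simps)
  then consider good | q where "lift 1 q" using all[of n] by auto
  then have good
  proof cases
    case 2
    then have "q 1 \<in> cball p R" "g (q 1) = c 1" by (simp_all add: lift_def)
    then show ?thesis using far by (metis image_eqI)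
  qed
  then show thesis using that unfolding good_def lift_def by metis
qed

lemma countable_critical_points:
  assumes "g holomorphic_on UNIV" "\<not> g constant_on UNIV"
  shows "countable {z. deriv g z = 0}"
proof (cases "deriv g constant_on UNIV")
  case True
  then obtain c where c: "\<And>z. deriv g z = c" by (auto simp: constant_on_def)
  have "c \<noteq> 0"
  proof
    assume "c = 0"
    then have "(g has_field_derivative 0) (at z)" for z
      using holomorphic_derivI[OF assms(1) open_UNIV UNIV_I, of z] c by simp
    then obtain k where "\<And>z. g z = k"
      using has_field_derivative_zero_constant[of UNIV g] by auto
    then show False using assms(2) by (auto simp: constant_on_def)
  qed
  then show ?thesis by (simp add: c)
next
  case False
  moreover have "fsigma (\<Union>((\<lambda>_::nat. UNIV :: complex set) ` UNIV))"
    by (rule fsigma.intros) simp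
  ultimately show ?thesis
    using holomorphic_countable_zeros[of "deriv g" UNIV] holomorphic_deriv[OF assms(1) open_UNIV]
    by (simp add: connected_UNIV)
qed


subsection \<open>Local connectedness and unbounded Fatou components\<close>

text \<open>The points of \<open>X\<close> at distance at least \<open>e'\<close> from
  \<open>S\<close> form a compact set whose image misses \<open>S\<close>, hence stays at positive
  distance from it. This is what keeps lifts of an arc near J themselves near J.\<close>

lemma preimage_near_closed_set:
  fixes g :: "complex \<Rightarrow> complex"
  assumes "continuous_on UNIV g" "closed S" "\<And>z. g z \<in> S \<longleftrightarrow> z \<in> S" "compact X" "0 < e'"
  obtains e where "0 < e" "\<And>z w. z \<in> X \<Longrightarrow> w \<in> S \<Longrightarrow> dist w (g z) < e \<Longrightarrow> \<exists>v\<in>S. dist v z < e'"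
proof -
  define X' where "X' = X - (\<Union>v\<in>S. ball v e')"
  have "compact X'" unfolding X'_def using assms(4) by (intro compact_diff) auto
  then have "compact (g ` X')"
    by (intro compact_continuous_image continuous_on_subset[OF assms(1)]) auto
  moreover have "g ` X' \<inter> S = {}"
    using assms(3,5) by (force simp: X'_def)
  ultimately obtain e where e: "0 < e" "\<And>x y. x \<in> g ` X' \<Longrightarrow> y \<in> S \<Longrightarrow> e \<le> dist x y"
    using separate_compact_closed[OF _ assms(2)] by metis
  show thesis
  proof (rule that[OF e(1)])
    fix z w assume zw: "z \<in> X" "w \<in> S" "dist w (g z) < e"
    then have "z \<notin> X'" using e(2)[of "g z" w] by (auto simp: dist_commute)
    then show "\<exists>v\<in>S. dist v z < e'" using zw by (auto simp: X'_def)
  qed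
qed

text \<open>A uniform version of \<open>out\<close> for points near \<open>S\<close> and thickened
  sets. If it failed along \<open>\<epsilon> n\<close>, some \<open>l\<close> in \<open>S\<close>
  would be a limit of the bad points; a path that leads from \<open>l\<close> far away and avoids a
  compact part of \<open>S\<close> would also free the bad points close to \<open>l\<close>.\<close>

lemma uniformly_outside_nhd:
  fixes S :: "complex set"
  assumes "closed S" and out: "\<And>K p. compact K \<Longrightarrow> K \<subseteq> S \<Longrightarrow> p \<in> S \<Longrightarrow> p \<notin> K \<Longrightarrow> p \<in> outside K"
    and "compact X" "0 < d"
  obtains e where "0 < e" "\<And>p w. p \<in> X \<Longrightarrow> w \<in> S \<Longrightarrow> dist w p < e \<Longrightarrow>
      p \<in> outside {z \<in> cball z0 R. (\<exists>w\<in>S. dist w z \<le> e) \<and> d \<le> dist z p}"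
proof (rule ccontr)
  assume "\<not> thesis"
  define Z where "Z e p = {z \<in> cball z0 R. (\<exists>w\<in>S. dist w z \<le> e) \<and> d \<le> dist z p}" for e p
  define \<epsilon> where "\<epsilon> n = inverse (real (Suc n))" for n
  have "\<exists>p w. p \<in> X \<and> w \<in> S \<and> dist w p < \<epsilon> n \<and> p \<notin> outside (Z (\<epsilon> n) p)" for n
  proof (rule ccontr)
    assume "\<not> ?thesis"
    then have "p \<in> outside (Z (\<epsilon> n) p)" if "p \<in> X" "w \<in> S" "dist w p < \<epsilon> n" for p w
      using that by fast
    moreover have "0 < \<epsilon> n" by (simp add: \<epsilon>_def)
    ultimately have thesis using that[of "\<epsilon> n"] unfolding Z_def by simp
    then show False using \<open>\<not> thesis\<close> by simp
  qed
  then obtain p w where pw: "\<And>n. p n \<in> X" "\<And>n. w n \<in> S" "\<And>n. dist (w n) (p n) < \<epsilon> n"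
    "\<And>n. p n \<notin> outside (Z (\<epsilon> n) (p n))"
    by metis
  obtain l r where l: "l \<in> X" "strict_mono (r :: nat \<Rightarrow> nat)" "(p \<circ> r) \<longlonglongrightarrow> l"
    using assms(3) pw(1) unfolding compact_def by (metis (no_types, lifting))
  have "\<epsilon> \<longlonglongrightarrow> 0" unfolding \<epsilon>_def by (rule LIMSEQ_inverse_real_of_nat)
  then have er0: "(\<epsilon> \<circ> r) \<longlonglongrightarrow> 0" using l(2) by (rule LIMSEQ_subseq_LIMSEQ)
  have "(\<lambda>n. (\<epsilon> \<circ> r) n + dist ((p \<circ> r) n) l) \<longlonglongrightarrow> 0 + 0"
    by (intro tendsto_add er0 iffD1[OF tendsto_dist_iff l(3)])
  then have lim: "(\<lambda>n. (\<epsilon> \<circ> r) n + dist ((p \<circ> r) n) l) \<longlonglongrightarrow> 0" by simp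
  have "dist (w (r n)) l \<le> (\<epsilon> \<circ> r) n + dist ((p \<circ> r) n) l" for n
    using dist_triangle[of "w (r n)" l "p (r n)"] pw(3)[of "r n"] by simp
  then have "(\<lambda>n. dist (w (r n)) l) \<longlonglongrightarrow> 0"
    by (intro tendsto_sandwich[OF _ _ tendsto_const lim] always_eventually allI) auto
  then have "(\<lambda>n. w (r n)) \<longlonglongrightarrow> l" by (rule iffD2[OF tendsto_dist_iff])
  then have lS: "l \<in> S"
    using closed_sequentially[OF assms(1), of "\<lambda>n. w (r n)" l] pw(2) by auto
  \<comment> \<open>Slack in both conditions: points of \<open>S\<close> within 1 of the disc of
    radius \<open>R\<close> are in the larger disc, and \<open>d/2\<close> absorbs two errors below
    \<open>d/8\<close>.\<close>
  define K where "K = S \<inter> cball z0 (R + 2) - ball l (d/2)"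
  have K: "compact K"
    unfolding K_def using assms(1) by (intro compact_diff closed_Int_compact) auto
  have "l \<in> outside K"
    by (rule out[OF K _ lS]) (use assms(4) in \<open>auto simp: K_def\<close>)
  then have "\<not> bounded (connected_component_set (- K) l)" by (simp add: outside)
  then obtain y where y: "connected_component (- K) l y" "R + 1 < dist z0 y"
    unfolding bounded_any_center[where a = z0] by (metis mem_Collect_eq linorder_not_le)
  have "open (- K)" using K compact_imp_closed by blast
  then have "path_component (- K) l y"
    using y(1) by (simp add: open_path_connected_component)
  then obtain \<gamma> where \<gamma>: "path \<gamma>" "path_image \<gamma> \<subseteq> - K" "pathstart \<gamma> = l" "pathfinish \<gamma> = y"
    unfolding path_component_def by blast
  obtain D where D: "0 < D" "\<And>x y. x \<in> path_image \<gamma> \<Longrightarrow> y \<in> K \<Longrightarrow> D \<le> dist x y"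
    using separate_compact_closed[OF compact_path_image[OF \<gamma>(1)] compact_imp_closed[OF K]] \<gamma>(2) by blast
  have "\<forall>\<^sub>F n in sequentially. (\<epsilon> \<circ> r) n < min D (min (d/8) 1)"
    by (rule order_tendstoD(2)[OF er0]) (use D assms(4) in auto)
  moreover have "\<forall>\<^sub>F n in sequentially. dist ((p \<circ> r) n) l < d/8"
    by (rule tendstoD[OF l(3)]) (use assms(4) in auto)
  ultimately have "\<forall>\<^sub>F n in sequentially. (\<epsilon> \<circ> r) n < min D (min (d/8) 1) \<and> dist ((p \<circ> r) n) l < d/8"
    by (rule eventually_conj)
  then obtain m where m: "\<epsilon> (r m) < D" "\<epsilon> (r m) < d/8" "\<epsilon> (r m) < 1" "dist (p (r m)) l < d/8"
    by (auto simp: eventually_sequentially)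
  define P e where "P = p (r m)" and "e = \<epsilon> (r m)"
  \<comment> \<open>The escape route from \<open>P\<close>: the segment is too close to
    \<open>P\<close> to meet \<open>Z e P\<close>, the path keeps distance \<open>D\<close> from
    \<open>K\<close>, and the last part is off the disc.\<close>
  define C where "C = closed_segment P l \<union> path_image \<gamma> \<union> (- cball z0 R)"
  have "connected (- cball z0 R)"
    by (rule connected_complement_bounded_convex) auto
  moreover have "l \<in> path_image \<gamma>" "y \<in> path_image \<gamma>" using \<gamma> pathstart_in_path_image pathfinish_in_path_image by metis+
  moreover have "y \<in> - cball z0 R" using y(2) by auto
  ultimately have "connected C"
    unfolding C_def using connected_path_image[OF \<gamma>(1)]
    by (intro connected_Un) auto
  moreover have "C \<inter> Z e P = {}"
  proof -
    have "z \<notin> Z e P" if "z \<in> closed_segment P l" for z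
    proof -
      have "dist z P \<le> dist P l" using segment_bound(1)[OF that] by (simp add: dist_norm norm_minus_commute)
      then show ?thesis using m(4) assms(4) by (auto simp: Z_def P_def)
    qed
    moreover have "z \<notin> Z e P" if z: "z \<in> path_image \<gamma>" for z
    proof
      assume "z \<in> Z e P"
      then obtain v where v: "dist z0 z \<le> R" "v \<in> S" "dist v z \<le> e" "d \<le> dist z P" by (auto simp: Z_def)
      have "d \<le> dist z v + dist v l + dist l P"
        using v(4) dist_triangle[of z P v] dist_triangle[of v P l] by linarith
      then have "d/2 \<le> dist l v"
        using v m(2,4) assms(4) by (simp add: e_def P_def dist_commute)
      moreover have "dist z0 v \<le> R + 2"
        using dist_triangle[of z0 v z] v m(3) by (simp add: e_def dist_commute)
      ultimately have "v \<in> K" using v by (auto simp: K_def)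
      then show False using D(2)[OF z] v(3) m(1) by (force simp: e_def dist_commute)
    qed
    ultimately show ?thesis by (auto simp: C_def Z_def)
  qed
  moreover have "P \<in> C" by (auto simp: C_def)
  ultimately have "C \<subseteq> connected_component_set (- Z e P) P"
    by (intro connected_component_maximal) auto
  moreover have "\<not> bounded C"
    unfolding C_def using cobounded_imp_unbounded[of "- cball z0 R"] bounded_subset by auto
  ultimately have "P \<in> outside (Z e P)"
    using bounded_subset unfolding outside by blast
  then show False using pw(4)[of "r m"] by (simp add: P_def e_def)
qed

lemma three_in_fibre:
  assumes "finite B" "finite D" "l ` B \<subseteq> D" "2 * card D < card B"
  obtains x b where "inj_on b {..<3::nat}" "\<And>i. i < 3 \<Longrightarrow> b i \<in> B" "\<And>i. i < 3 \<Longrightarrow> l (b i) = x"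
proof -
  have "\<exists>x\<in>D. 3 \<le> card {b \<in> B. l b = x}"
  proof (rule ccontr)
    assume "\<not> ?thesis"
    then have le: "card {b \<in> B. l b = x} \<le> 2" if "x \<in> D" for x using that by force
    have "B = (\<Union>x\<in>D. {b \<in> B. l b = x})" using assms(3) by auto
    then have "card B \<le> (\<Sum>x\<in>D. card {b \<in> B. l b = x})"
      using card_UN_le[OF assms(2), of "\<lambda>x. {b \<in> B. l b = x}"] by simp
    also have "\<dots> \<le> (\<Sum>x\<in>D. 2)" by (intro sum_mono le)
    finally show False using assms(4) by simp
  qed
  then obtain x where x: "3 \<le> card {b \<in> B. l b = x}" by blast
  have "card {..<3::nat} \<le> card {b \<in> B. l b = x}" using x by simp
  then obtain b where "b ` {..<3} \<subseteq> {b \<in> B. l b = x}" "inj_on b {..<3::nat}"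
    using card_le_inj[of "{..<3::nat}" "{b \<in> B. l b = x}"] assms(1) by auto
  then show thesis by (intro that[of b x]) auto
qed

text \<open>The radii about \<open>w\<close> are staggered: \<open>A\<close> within 1, the crossing
  circle between 2 and 3, the ends of the lifts at 5, Julia points near these ends between 4 and 6
  with pieces of radius 1/2, and accessibility within 7. All thickenings are at most 1/4.\<close>

theorem corollary1p2:
  fixes f :: "complex \<Rightarrow> complex"
  assumes "transcendental_entire f"
    and "\<exists>U \<in> components (fatou_set f). \<not> bounded U"
  shows "\<not> locally connected (julia_set f)"
proof
  define J where "J = julia_set f"
  assume "locally connected (julia_set f)"
  then have lc: "locally connected J" by (simp add: J_def)
  note te = assms(1)
  note hol = transcendental_entireD(1)[OF te]
  obtain U where U: "U \<in> components (fatou_set f)" "\<not> bounded U" using assms(2) by blast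
  have cl: "closed J" unfolding J_def by (rule closed_julia_set)
  have con: "connected J" using connected_julia_set[OF te] lc by (simp add: J_def)
  have unb: "\<not> bounded J" unfolding J_def by (rule unbounded_julia_set[OF te])
  have Jiff: "(f ^^ n) z \<in> J \<longleftrightarrow> z \<in> J" for n z unfolding J_def by (rule julia_set_iff[OF te])
  have outK: "p \<in> outside K" if "compact K" "K \<subseteq> J" "p \<in> J" "p \<notin> K" for K p
    using julia_set_outside_compact[OF te U] that unfolding J_def by blast

  \<comment> \<open>A base point that is neither exceptional nor a critical value\<close>
  obtain a where a: "\<And>w. w \<noteq> a \<Longrightarrow> infinite (f -` {w})" using transcendental_infinite_preimage[OF te] by metis
  define Cr where "Cr n = {z. deriv (f ^^ n) z = 0}" for n
  have cCr: "countable (Cr n)" for n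
    unfolding Cr_def by (intro countable_critical_points holomorphic_on_funpow hol funpow_not_constant te)
  \<comment> \<open>All iterates are included because the one to be lifted under is determined only
    later.\<close>
  define CV where "CV = (\<Union>n. (f ^^ n) ` Cr n)"
  have cCV: "countable CV" unfolding CV_def using cCr by auto
  obtain j1 j2 where "j1 \<in> J" "j2 \<in> J" "j1 \<noteq> j2"
    using julia_set_not_subset_singleton[OF te] unfolding J_def by blast
  then have "uncountable J" using connected_uncountable[OF con] by blast
  then have "\<not> J \<subseteq> insert a CV" using cCV countable_subset[of J "insert a CV"] by auto
  then obtain w where w: "w \<in> J" "w \<noteq> a" "w \<notin> CV" by blast

  \<comment> \<open>Small connected pieces of J at the base point and in an annulus\<close>
  obtain A d where A: "compact A" "connected A" "A \<subseteq> J" "A \<subseteq> ball w 1" "w \<in> A" "0 < d" "J \<inter> ball w d \<subseteq> A"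
    by (rule locally_connected_compact_nhd[OF cl lc w(1) zero_less_one])
  define Y where "Y = J \<inter> cball w 6 - ball w 4"
  have cY: "compact Y" unfolding Y_def using cl by (intro compact_diff closed_Int_compact) auto
  define nh where "nh x V e \<longleftrightarrow> connected V \<and> compact V \<and> V \<subseteq> J \<and> V \<subseteq> ball x (1/2) \<and> 0 < e \<and> J \<inter> ball x e \<subseteq> V" for x V e
  have "\<exists>V e. nh x V e" if x: "x \<in> Y" for x
  proof -
    have xJ: "x \<in> J" using x by (simp add: Y_def)
    obtain V e where "compact V" "connected V" "V \<subseteq> J" "V \<subseteq> ball x (1/2)" "x \<in> V" "0 < e" "J \<inter> ball x e \<subseteq> V"
      by (rule locally_connected_compact_nhd[OF cl lc xJ, of "1/2"]) auto
    then show ?thesis unfolding nh_def by blast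
  qed
  then obtain V de where "\<And>x. x \<in> Y \<Longrightarrow> nh x (V x) (de x)" by metis
  then have V: "\<And>x. x \<in> Y \<Longrightarrow> connected (V x)" "\<And>x. x \<in> Y \<Longrightarrow> compact (V x)" "\<And>x. x \<in> Y \<Longrightarrow> V x \<subseteq> J"
    "\<And>x. x \<in> Y \<Longrightarrow> V x \<subseteq> ball x (1/2)" "\<And>x. x \<in> Y \<Longrightarrow> 0 < de x" "\<And>x. x \<in> Y \<Longrightarrow> J \<inter> ball x (de x) \<subseteq> V x"
    by (simp_all add: nh_def)
  have "Y \<subseteq> (\<Union>x\<in>Y. ball x (de x))" using V(5) by force
  then obtain D where D: "D \<subseteq> Y" "finite D" "Y \<subseteq> (\<Union>x\<in>D. ball x (de x))"
    by (rule compactE_image[OF cY open_ball])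

  \<comment> \<open>Many points of the first piece over the base point\<close>
  obtain B0 where B0: "B0 \<subseteq> f -` {w}" "finite B0" "card B0 = 2 * card D + 2"
    using infinite_arbitrarily_large[OF a[OF w(2)]] by metis
  have wd: "w \<in> ball w d" using A(6) by simp
  obtain n where n: "\<And>x y. x \<in> B0 \<Longrightarrow> y \<in> B0 \<Longrightarrow> x \<noteq> y \<Longrightarrow> x \<in> (f ^^ n) ` ball w d \<or> y \<in> (f ^^ n) ` ball w d"
    by (rule julia_set_blow_up[OF te w(1)[unfolded J_def] open_ball connected_ball wd B0(2)]) blast
  define B1 where "B1 = B0 \<inter> (f ^^ n) ` ball w d"
  have "B0 - B1 \<subseteq> {SOME x. x \<in> B0 - B1}"
  proof
    fix x assume x: "x \<in> B0 - B1"
    define y where "y = (SOME x. x \<in> B0 - B1)"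
    have "y \<in> B0 - B1" unfolding y_def using x by (rule someI)
    then have "x = y" using n[of x y] x by (auto simp: B1_def)
    then show "x \<in> {SOME x. x \<in> B0 - B1}" by (simp add: y_def)
  qed
  then have "card (B0 - B1) \<le> 1" using card_mono[OF finite.insertI[OF finite.emptyI]] by fastforce
  \<comment> \<open>The surplus of 2 in the size of \<open>B0\<close> allows for the loss of one
    point and still leaves more than \<open>2 * card D\<close>.\<close>
  then have cB1: "2 * card D < card B1"
    using B0 card_Diff_subset[of B1 B0] finite_subset[of B1 B0] card_mono[of B0 B1] by (auto simp: B1_def)
  define \<beta> where "\<beta> b = (SOME x. x \<in> ball w d \<and> (f ^^ n) x = b)" for b
  have \<beta>: "\<beta> b \<in> ball w d" "(f ^^ n) (\<beta> b) = b" if b: "b \<in> B1" for b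
  proof -
    have "\<exists>x. x \<in> ball w d \<and> (f ^^ n) x = b" using b by (auto simp: B1_def)
    then have "\<beta> b \<in> ball w d \<and> (f ^^ n) (\<beta> b) = b" unfolding \<beta>_def by (rule someI_ex)
    then show "\<beta> b \<in> ball w d" "(f ^^ n) (\<beta> b) = b" by auto
  qed

  define g where "g = f ^^ Suc n"
  have holg: "g holomorphic_on UNIV" unfolding g_def by (rule holomorphic_on_funpow[OF hol])
  have cg: "continuous_on S g" for S
    using holg holomorphic_on_imp_continuous_on continuous_on_subset by blast
  have gJ: "g z \<in> J \<longleftrightarrow> z \<in> J" for z unfolding g_def by (rule Jiff)
  have gw: "g (\<beta> b) = w" if "b \<in> B1" for b
    using \<beta>(2)[OF that] that B0(1) by (auto simp: g_def B1_def)
  have \<beta>A: "\<beta> b \<in> A" if "b \<in> B1" for b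
    using \<beta>(1)[OF that] gw[OF that] gJ[of "\<beta> b"] w(1) A(7) by auto
  have crit: "deriv g z \<noteq> 0" if "g z \<notin> CV" for z
  proof
    assume "deriv g z = 0"
    then have "z \<in> Cr (Suc n)" unfolding Cr_def g_def by blast
    then have "g z \<in> CV" unfolding CV_def g_def by blast
    then show False using that by simp
  qed

  \<comment> \<open>A circle without critical points\<close>
  have "countable (dist w ` Cr (Suc n))" using cCr by blast
  then have "\<not> {2<..<3} \<subseteq> dist w ` Cr (Suc n)"
    using countable_subset[of "{2<..<3}" "dist w ` Cr (Suc n)"] uncountable_open_interval[of 2 "3::real"] by auto
  then obtain r where r: "2 < r" "r < 3" "r \<notin> dist w ` Cr (Suc n)"
    by (meson greaterThanLessThan_iff subsetI)
  have nzr: "deriv g z \<noteq> 0" if "z \<in> sphere w r" for z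
    using that r(3) unfolding Cr_def g_def by auto
  \<comment> \<open>On discs of radius \<open>\<rho>\<close> about the circle the sheets of
    \<open>g\<close> are separated; as long as the arc stays within \<open>\<eta>\<close>, a lift
    cannot leave such a disc.\<close>
  obtain \<rho> \<eta> where \<rho>: "0 < \<rho>" "0 < \<eta>" "\<And>x. x \<in> sphere w r \<Longrightarrow> inj_on g (ball x \<rho>)"
    "\<And>x. x \<in> sphere w r \<Longrightarrow> ball (g x) \<eta> \<subseteq> g ` ball x \<rho>"
  proof (rule uniform_local_inverse[OF holg compact_sphere nzr])
    fix \<rho> \<eta> :: real
    assume "0 < \<rho>" "0 < \<eta>" "\<And>x. x \<in> sphere w r \<Longrightarrow> inj_on g (ball x \<rho>)"
      "\<And>x. x \<in> sphere w r \<Longrightarrow> ball (g x) \<eta> \<subseteq> g ` ball x \<rho>"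
    then show thesis by (rule that)
  qed

  \<comment> \<open>An end point in J beyond the image of the disc\<close>
  have "bounded (g ` cball w 5)" by (intro compact_imp_bounded compact_continuous_image cg) auto
  then obtain Bd where Bd: "\<And>z. z \<in> cball w 5 \<Longrightarrow> norm (g z) \<le> Bd"
    unfolding bounded_iff by blast
  define m0 where "m0 = max Bd (norm w)"
  have "countable (norm ` CV)" using cCV by blast
  then have "\<not> {m0<..<m0 + 1} \<subseteq> norm ` CV"
    using countable_subset[of "{m0<..<m0 + 1}" "norm ` CV"] uncountable_open_interval[of m0 "m0 + 1"] by auto
  then obtain R where R: "m0 < R" "R \<notin> norm ` CV"
    by (meson greaterThanLessThan_iff subsetI)
  obtain z1 where z1: "z1 \<in> J" "R < norm z1" using unb by (meson bounded_iff linorder_not_le)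
  have "connected (norm ` J)" by (intro connected_continuous_image continuous_intros con)
  then have "R \<in> norm ` J"
    using connectedD_interval[of "norm ` J" "norm w" "norm z1" R] w(1) z1 R(1) by (auto simp: m0_def)
  then obtain y where y: "y \<in> J" "norm y = R" by auto
  have yn: "y \<notin> CV" "w \<noteq> y" "y \<notin> g ` cball w 5"
  proof -
    show "y \<notin> CV" using y(2) R(2) by blast
    show "w \<noteq> y" using y(2) R(1) by (auto simp: m0_def)
    show "y \<notin> g ` cball w 5"
    proof
      assume "y \<in> g ` cball w 5"
      then have "norm y \<le> Bd" using Bd by blast
      then show False using y(2) R(1) by (simp add: m0_def)
    qed
  qed

  \<comment> \<open>The constants and the arc\<close>
  obtain \<kappa> where \<kappa>: "0 < \<kappa>"
    "\<And>e C. 0 < e \<Longrightarrow> countable C \<Longrightarrow> w \<notin> C \<Longrightarrow> y \<notin> C \<Longrightarrow>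
      \<exists>c. arc c \<and> pathstart c = w \<and> pathfinish c = y \<and> path_image c \<inter> C = {} \<and>
        (\<forall>z\<in>path_image c. \<exists>v\<in>J. dist v z < e) \<and>
        (\<forall>s u t. 0 \<le> s \<longrightarrow> s \<le> u \<longrightarrow> u \<le> t \<longrightarrow> t \<le> 1 \<longrightarrow> dist (c s) (c t) < \<kappa> \<longrightarrow>
            dist (c u) (c s) < \<eta> \<and> dist (c u) (c t) < \<eta>)"
    by (rule nonbacktracking_arcs[OF cl con lc w(1) y(1) yn(2) \<rho>(2)]) (rule that)
  have "uniformly_continuous_on (cball w 5) g" by (intro compact_uniformly_continuous cg) auto
  then obtain \<theta> where \<theta>: "0 < \<theta>" "\<And>x x'. x \<in> cball w 5 \<Longrightarrow> x' \<in> cball w 5 \<Longrightarrow> dist x' x < \<theta> \<Longrightarrow> dist (g x') (g x) < \<kappa>"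
    using \<kappa>(1) unfolding uniformly_continuous_on_def by metis
  \<comment> \<open>\<open>\<theta>\<close> brings images within \<open>\<kappa>\<close>,
    \<open>\<rho>\<close> keeps two points in one disc of injectivity, and \<open>1/4\<close> keeps
    the circle away from both thickened pieces.\<close>
  define h where "h = min (min \<theta> \<rho>) (1/4)"
  have h: "0 < h" "h \<le> \<theta>" "h \<le> \<rho>" "h \<le> 1/4" using \<theta>(1) \<rho>(1) by (auto simp: h_def)
  obtain e1 where e1: "0 < e1" "\<And>p v. p \<in> sphere w r \<Longrightarrow> v \<in> J \<Longrightarrow> dist v p < e1 \<Longrightarrow>
      p \<in> outside {z \<in> cball w 7. (\<exists>v\<in>J. dist v z \<le> e1) \<and> h \<le> dist z p}"
    by (rule uniformly_outside_nhd[OF cl _ compact_sphere h(1)]; (rule outK | rule that))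
  define e' where "e' = min e1 (1/4)"
  have e': "0 < e'" "e' \<le> e1" "e' \<le> 1/4" using e1(1) by (auto simp: e'_def)
  obtain e where e: "0 < e" "\<And>z v. z \<in> cball w 5 \<Longrightarrow> v \<in> J \<Longrightarrow> dist v (g z) < e \<Longrightarrow> \<exists>u\<in>J. dist u z < e'"
    by (rule preimage_near_closed_set[OF cg cl gJ compact_cball e'(1)]) (rule that)
  obtain c where c: "arc c" "pathstart c = w" "pathfinish c = y" "path_image c \<inter> CV = {}"
    "\<And>z. z \<in> path_image c \<Longrightarrow> \<exists>v\<in>J. dist v z < e"
    "\<And>s u t. 0 \<le> s \<Longrightarrow> s \<le> u \<Longrightarrow> u \<le> t \<Longrightarrow> t \<le> 1 \<Longrightarrow> dist (c s) (c t) < \<kappa> \<Longrightarrow>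
            dist (c u) (c s) < \<eta> \<and> dist (c u) (c t) < \<eta>"
    using \<kappa>(2)[OF e(1) cCV w(3) yn(1)] by blast
  have nzc: "deriv g z \<noteq> 0" if "g z \<in> path_image c" for z
    using crit c(4) that by blast

  \<comment> \<open>The lifts of the arc\<close>
  define lift where "lift b q T \<longleftrightarrow> T \<in> {0..1} \<and> continuous_on {0..T} q \<and> q 0 = \<beta> b \<and> q T \<in> sphere w 5 \<and>
      (\<forall>t\<in>{0..T}. q t \<in> cball w 5 \<and> g (q t) = c t)" for b q T
  have "\<exists>q T. lift b q T" if b: "b \<in> B1" for b
  proof -
    have "\<beta> b \<in> ball w 5" using \<beta>A[OF b] A(4) by auto
    moreover have "g (\<beta> b) = c 0" using gw[OF b] c(2) by (simp add: pathstart_def)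
    moreover have "c 1 \<notin> g ` cball w 5" using yn(3) c(3) by (simp add: pathfinish_def)
    ultimately obtain q T where "T \<in> {0..1}" "continuous_on {0..T} q" "q 0 = \<beta> b" "q T \<in> sphere w 5"
        "\<And>t. t \<in> {0..T} \<Longrightarrow> q t \<in> cball w 5 \<and> g (q t) = c t"
      using lift_path_to_sphere[OF holg arc_imp_path[OF c(1)] nzc] by metis
    then show ?thesis unfolding lift_def by blast
  qed
  then obtain q T where qT: "\<And>b. b \<in> B1 \<Longrightarrow> lift b (q b) (T b)" by metis
  have q: "T b \<in> {0..1}" "continuous_on {0..T b} (q b)" "q b 0 = \<beta> b" "q b (T b) \<in> sphere w 5"
     if "b \<in> B1" for b
    using qT[OF that] by (simp_all add: lift_def)
  have qt: "q b t \<in> cball w 5" "g (q b t) = c t" if "b \<in> B1" "t \<in> {0..T b}" for b t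
    using qT[OF that(1)] that(2) by (simp_all add: lift_def)
  have im: "c t \<in> path_image c" if "b \<in> B1" "t \<in> {0..T b}" for b t
    using q(1)[OF that(1)] that(2) by (auto simp: path_image_def)
  have near: "\<exists>u\<in>J. dist u (q b t) < e'" if "b \<in> B1" "t \<in> {0..T b}" for b t
    using e(2)[OF qt(1)[OF that]] c(5)[OF im[OF that]] qt(2)[OF that] by auto
  \<comment> \<open>An arc is injective, so lifts can meet only at equal parameters. Uniqueness back
    to the parameter 0 would then identify the starting points, which \<open>f ^^ n\<close>
    distinguishes.\<close>
  have qdis: "q b s \<noteq> q b' t" if b: "b \<in> B1" "b' \<in> B1" "b \<noteq> b'" and st: "s \<in> {0..T b}" "t \<in> {0..T b'}" for b b' s t
  proof
    assume eq: "q b s = q b' t"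
    then have "c s = c t" using qt(2)[OF b(1) st(1)] qt(2)[OF b(2) st(2)] by metis
    moreover have "s \<in> {0..1}" "t \<in> {0..1}" using q(1)[OF b(1)] q(1)[OF b(2)] st by auto
    ultimately have "s = t" using c(1) by (auto simp: arc_def inj_on_def)
    have "q b 0 = q b' 0"
    proof (rule lift_unique[OF holg, of 0 s "q b" "q b'"])
      show "continuous_on {0..s} (q b)" "continuous_on {0..s} (q b')"
        using q(2)[OF b(1)] q(2)[OF b(2)] st \<open>s = t\<close> by (auto intro: continuous_on_subset)
      show "g (q b x) = g (q b' x)" if "x \<in> {0..s}" for x
        using that st \<open>s = t\<close> qt(2)[OF b(1), of x] qt(2)[OF b(2), of x] by auto
      show "deriv g (q b x) \<noteq> 0" if "x \<in> {0..s}" for x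
        using that st qt(2)[OF b(1), of x] im[OF b(1), of x] nzc[of "q b x"] by auto
      show "q b s = q b' s" using eq \<open>s = t\<close> by simp
    qed (use st in auto)
    then show False using q(3)[OF b(1)] q(3)[OF b(2)] \<beta>(2)[OF b(1)] \<beta>(2)[OF b(2)] b(3) by metis
  qed

  \<comment> \<open>Three lifts that arrive at the same piece\<close>
  have "\<exists>x\<in>D. \<exists>v\<in>V x. dist v (q b (T b)) < e'" if b: "b \<in> B1" for b
  proof -
    have "T b \<in> {0..T b}" using q(1)[OF b] by auto
    then obtain u where u: "u \<in> J" "dist u (q b (T b)) < e'" using near[OF b] by blast
    have "dist w (q b (T b)) = 5" using q(4)[OF b] by simp
    then have "dist w u \<le> 5 + e'" "5 - e' \<le> dist w u"
      using u(2) dist_triangle[of w u "q b (T b)"] dist_triangle[of w "q b (T b)" u] by (auto simp: dist_commute)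
    then have "u \<in> Y" using u(1) e'(3) by (auto simp: Y_def)
    then obtain x where x: "x \<in> D" "u \<in> ball x (de x)" using D(3) by blast
    then have "u \<in> V x" using V(6)[of x] D(1) u(1) by blast
    then show ?thesis using x u by blast
  qed
  then obtain l where l: "\<And>b. b \<in> B1 \<Longrightarrow> l b \<in> D" "\<And>b. b \<in> B1 \<Longrightarrow> \<exists>v\<in>V (l b). dist v (q b (T b)) < e'"
    by metis
  have "finite B1" using B0(2) by (simp add: B1_def)
  then obtain x b where b: "inj_on b {..<3::nat}" "\<And>i. i < 3 \<Longrightarrow> b i \<in> B1" "\<And>i. i < 3 \<Longrightarrow> l (b i) = x"
    by (rule three_in_fibre[OF _ D(2) _ cB1, of l]) (use l(1) in blast)+
  have bne: "b i \<noteq> b j" if "i < 3" "j < 3" "i \<noteq> j" for i j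
    using b(1) that by (auto simp: inj_on_def)
  have xY: "x \<in> Y" using l(1)[OF b(2)[of 0]] b(3)[of 0] D(1) by auto

  \<comment> \<open>The theta configuration\<close>
  define A' where "A' = (\<Union>a\<in>A. cball a e')"
  define W where "W = (\<Union>v\<in>V x. cball v e')"
  have A': "dist w z < 2" if z: "z \<in> A'" for z
  proof -
    obtain a where "a \<in> A" "dist a z \<le> e'" using z by (auto simp: A'_def)
    then show ?thesis using A(4) dist_triangle[of w z a] e'(3) by fastforce
  qed
  have W: "3 + h \<le> dist w z \<and> dist w z \<le> 7" if z: "z \<in> W" for z
  proof -
    obtain v where v: "v \<in> V x" "dist v z \<le> e'" using z by (auto simp: W_def)
    have "dist x v < 1/2" using V(4)[OF xY] v(1) by auto
    moreover have "4 \<le> dist w x" "dist w x \<le> 6" using xY by (auto simp: Y_def)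
    ultimately show ?thesis
      using v(2) e'(3) h(4) dist_triangle[of w x v] dist_triangle[of w v z] dist_triangle[of w z v] dist_triangle[of w v x]
      by (auto simp: dist_commute)
  qed
  show False
  proof (rule three_crossings_impossible[of A' w r W "\<lambda>i. T (b i)" "\<lambda>i. q (b i)"
        "\<lambda>i t. {z \<in> cball w 7. (\<exists>v\<in>J. dist v z \<le> e1) \<and> h \<le> dist z (q (b i) t)}"])
    show "path_connected A'" "path_connected W"
      unfolding A'_def W_def using A(2) V(1)[OF xY] e'(1) by (auto intro: path_connected_closed_nhd)
    show "closed A'" "closed W"
      unfolding A'_def W_def using A(1) V(2)[OF xY]
      by (auto intro: compact_imp_closed compact_minkowski_sum_cball)
    show "A' \<subseteq> ball w r" using A' r(1) by force
    show "W \<inter> cball w r = {}" using W r(2) h(1) by force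
    fix i :: nat assume i: "i < 3"
    note bi = b(2)[OF i]
    show "continuous_on {0..T (b i)} (q (b i))" "0 \<le> T (b i)" using q(1,2)[OF bi] by auto
    show "q (b i) 0 \<in> A'" using q(3)[OF bi] \<beta>A[OF bi] e'(1) by (auto simp: A'_def intro!: bexI[of _ "\<beta> (b i)"])
    show "q (b i) (T (b i)) \<in> W" using l(2)[OF bi] b(3)[OF i] less_imp_le by (fastforce simp: W_def)
    {
      fix t assume t: "t \<in> {0..T (b i)}" "dist w (q (b i) t) = r"
      show "q (b i) t \<in> outside {z \<in> cball w 7. (\<exists>v\<in>J. dist v z \<le> e1) \<and> h \<le> dist z (q (b i) t)}"
        using near[OF bi t(1)] e1(2)[of "q (b i) t"] t(2) e'(2) by force
      show "A' \<union> W \<subseteq> {z \<in> cball w 7. (\<exists>v\<in>J. dist v z \<le> e1) \<and> h \<le> dist z (q (b i) t)}"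
      proof
        fix z assume z: "z \<in> A' \<union> W"
        then have "\<exists>v\<in>J. dist v z \<le> e1"
          using A(3) V(3)[OF xY] e'(2) unfolding A'_def W_def by force
        moreover have "dist w z \<le> 7" using A'[of z] W[of z] z by auto
        moreover have "h \<le> dist z (q (b i) t)"
          using z
        proof
          assume "z \<in> A'"
          obtain a where "a \<in> A" "dist a z \<le> e'" using \<open>z \<in> A'\<close> by (auto simp: A'_def)
          then have "dist w z \<le> 5/4" using A(4) dist_triangle[of w z a] e'(3) by fastforce
          then show ?thesis using t(2) r(1) h(4) dist_triangle[of w "q (b i) t" z] by auto
        next
          assume "z \<in> W"
          then show ?thesis using W[of z] t(2) r(2) dist_triangle[of w z "q (b i) t"] by (auto simp: dist_commute)
        qed
        ultimately show "z \<in> {z \<in> cball w 7. (\<exists>v\<in>J. dist v z \<le> e1) \<and> h \<le> dist z (q (b i) t)}" by simp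
      qed
    }
    fix j :: nat assume j: "j < 3" "i \<noteq> j"
    note bj = b(2)[OF j(1)] and bij = bne[OF i j]
    show "q (b i) s \<noteq> q (b j) t" if "s \<in> {0..T (b i)}" "t \<in> {0..T (b j)}" for s t
      by (rule qdis[OF bi bj bij that])
    fix s t assume s: "s \<in> {0..T (b j)}" and t: "t \<in> {0..T (b i)}" "dist w (q (b i) t) = r"
    let ?p = "q (b i) t"
    have p: "?p \<in> sphere w r" using t by simp
    have s01: "0 \<le> s" "s \<le> 1" "0 \<le> t" "t \<le> 1" using q(1)[OF bi] q(1)[OF bj] s t by auto
    \<comment> \<open>Otherwise \<open>c s\<close> and \<open>c t\<close> are within
      \<open>\<kappa>\<close>, so the arc stays within \<open>\<eta>\<close> of \<open>c t\<close>
      between them. The lift taken at the later parameter, traced back to the earlier one, remains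
      in the disc of injectivity about \<open>?p\<close>; there it has the same image as the other
      lift, and the two would meet.\<close>
    have "h \<le> dist (q (b j) s) ?p"
    proof (rule ccontr)
      assume "\<not> h \<le> dist (q (b j) s) ?p"
      then have lt: "dist (q (b j) s) ?p < h" by simp
      have "dist (c s) (c t) < \<kappa>"
        using \<theta>(2)[OF qt(1)[OF bi t(1)] qt(1)[OF bj s]] lt h(2) qt(2)[OF bi t(1)] qt(2)[OF bj s] by auto
      then have dct: "dist (c s) (c t) < \<kappa>" "dist (c t) (c s) < \<kappa>" by (auto simp: dist_commute)
      have sb: "q (b j) s \<in> ball ?p \<rho>" using lt h(3) by (simp add: dist_commute)
      have gp: "g ?p = c t" using qt(2)[OF bi t(1)] .
      have inj: "inj_on g (ball ?p \<rho>)" and sub: "ball (g ?p) \<eta> \<subseteq> g ` ball ?p \<rho>" using \<rho>(3,4)[OF p] by auto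
      have pb: "?p \<in> ball ?p \<rho>" using \<rho>(1) by simp
      show False
      proof (cases "s \<le> t")
        case True
        have sT: "s \<in> {0..T (b i)}" using True t s01 by auto
        have "q (b i) s \<in> ball ?p \<rho>"
        proof (rule lift_stays_in_ball[OF holg inj sub, of s t "q (b i)" t])
          show "continuous_on {s..t} (q (b i))"
            using q(2)[OF bi] s01 t by (auto intro: continuous_on_subset)
          show "g (q (b i) u) \<in> ball (g ?p) \<eta>" if u: "u \<in> {s..t}" for u
            using c(6)[OF s01(1) _ _ s01(4) dct(1), of u] u qt(2)[OF bi, of u] gp s01 t by (auto simp: dist_commute)
        qed (use pb True in auto)
        then have "q (b i) s = q (b j) s"
          using inj_onD[OF inj, of "q (b i) s" "q (b j) s"] sb qt(2)[OF bi sT] qt(2)[OF bj s] by auto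
        then show False using qdis[OF bi bj bij sT s] by simp
      next
        case False
        have tT: "t \<in> {0..T (b j)}" using False s s01 by auto
        have "q (b j) t \<in> ball ?p \<rho>"
        proof (rule lift_stays_in_ball[OF holg inj sub, of t s "q (b j)" s])
          show "continuous_on {t..s} (q (b j))"
            using q(2)[OF bj] s01 s by (auto intro: continuous_on_subset)
          show "g (q (b j) u) \<in> ball (g ?p) \<eta>" if u: "u \<in> {t..s}" for u
            using c(6)[OF s01(3) _ _ s01(2) dct(2), of u] u qt(2)[OF bj, of u] gp s01 s by (auto simp: dist_commute)
        qed (use sb False in auto)
        then have "q (b j) t = ?p"
          using inj_onD[OF inj, of "q (b j) t" ?p] pb qt(2)[OF bj tT] gp by auto
        then show False using qdis[OF bi bj bij t(1) tT] by simp
      qed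
    qed
    moreover have "\<exists>v\<in>J. dist v (q (b j) s) \<le> e1" using near[OF bj s] e'(2) by force
    moreover have "dist w (q (b j) s) \<le> 7" using qt(1)[OF bj s] by auto
    ultimately show "q (b j) s \<in> {z \<in> cball w 7. (\<exists>v\<in>J. dist v z \<le> e1) \<and> h \<le> dist z ?p}" by simp
  qed
qed

end
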